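(* Assume that there exists a solution $U=(h,\mathrm q_1,\mathrm q_2)\in\mathcal V_\Omega$ of the shallow water system with its initial and boundary conditions (see context). Then, for the objective function $$J(\Omega)=\int_0^T\!\!\int_\Omega |\nabla U|^2\,dx\,dt+\int_0^T\!\!\int_\Omega |U-U_d|^2\,dx\,dt,\qquad U_d=(u_{1d},u_{2d},u_{3d}),$$ the adjoint equation for $P=(\mathrm p_1,\mathrm p_2,\mathrm p_3)$, i.e. $d_\varphi\mathcal L(0,U,P;\varphi')=0$ for all $\varphi'\in\mathcal V_\Omega$, is given in strong form on $\Omega\times[0,T]$ by $$-\frac{\partial \mathrm p_1}{\partial t}+\frac{\partial \mathrm p_2}{\partial x}\Big(\frac{\mathrm q_1^2}{h^2}-gh\Big)+\frac{\partial \mathrm p_2}{\partial y}\frac{\mathrm q_1\mathrm q_2}{h^2}+g\frac{\partial\psi}{\partial x}\mathrm p_2+\frac{\partial \mathrm p_3}{\partial x}\frac{\mathrm q_1\mathrm q_2}{h^2}+g\frac{\partial\psi}{\partial y}\mathrm p_3+\frac{\partial \mathrm p_3}{\partial y}\Big(\frac{\mathrm q_2^2}{h^2}-gh\Big)=2\Delta h-2(h-u_{1d}),$$ $$-\frac{\partial \mathrm p_2}{\partial t}-\frac{\partial \mathrm p_1}{\partial x}-2\frac{\partial \mathrm p_2}{\partial x}\frac{\mathrm q_1}{h}-\frac{\partial \mathrm p_2}{\partial y}\frac{\mathrm q_2}{h}-\frac{\partial \mathrm p_3}{\partial x}\frac{\mathrm q_2}{h}=2\Delta \mathrm q_1-2(\mathrm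 q_1-u_{2d}),$$ $$-\frac{\partial \mathrm p_3}{\partial t}-\frac{\partial \mathrm p_1}{\partial y}-\frac{\partial \mathrm p_2}{\partial y}\frac{\mathrm q_1}{h}-2\frac{\partial \mathrm p_3}{\partial y}\frac{\mathrm q_2}{h}-\frac{\partial \mathrm p_3}{\partial x}\frac{\mathrm q_1}{h}=2\Delta \mathrm q_2-2(\mathrm q_2-u_{3d}),$$ with the final condition $P(\cdot,T)=0$ in $\Omega$ and the boundary conditions on $\partial\Omega\times[0,T]$ $$\mathrm p_2n_x+\mathrm p_3n_y=0,$$ $$\Big(\frac{\mathrm q_1^2}{h}+\frac g2h^2\Big)\mathrm p_2n_x+\frac{\mathrm q_1\mathrm q_2}{h}\mathrm p_2n_y+\frac{\mathrm q_1\mathrm q_2}{h}\mathrm p_3n_x+\Big(\frac{\mathrm q_2^2}{h}+\frac g2h^2\Big)\mathrm p_3n_y=0.$$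
   Context: $\Omega\subset\mathbb R^2$ is a regular open domain with unit normal $n=(n_x,n_y)$ on $\partial\Omega$; space variables are $(x,y)$ ($dx$ denotes Lebesgue measure on $\Omega$; $x$ alone also denotes a point of $\Omega$), $T>0$, $g$ is the gravity constant, $\psi:\mathbb R^2\to\mathbb R$ is the bottom topography, $U_d$ is a given function in $L^2(\Omega\times[0,T])^3$. $|\nabla U|^2$ is the squared Frobenius norm of the spatial Jacobian, so $|\nabla U|^2=|\nabla h|^2+|\nabla\mathrm q_1|^2+|\nabla \mathrm q_2|^2$. Shallow water system: with water height $h$, velocities $u,v$ and $\mathrm q_1=hu$, $\mathrm q_2=hv$, on $\Omega\times[0,T]$ $$\partial_t h+\partial_x\mathrm q_1+\partial_y\mathrm q_2=0,$$ $$\partial_t\mathrm q_1+\partial_x\Big(\frac{\mathrm q_1^2}{h}+\frac g2h^2\Big)+\partial_y\Big(\frac{\mathrm q_1\mathrm q_2}{h}\Big)+gh\,\partial_x\psi=0,$$ $$\partial_t\mathrm q_2+\partial_x\Big(\frac{\mathrm q_1\mathrm q_2}{h}\Big)+\partial_y\Big(\frac{\mathrm q_2^2}{h}+\frac g2h^2\Big)+gh\,\partial_y\psi=0,$$ with $h(\cdot,0)=h_0$, $\mathrm q_1(\cdot,0)=\mathrm q_{10}$, $\mathrm q_2(\cdot,0)=\mathrm q_{20}$ in $\Omega$ and $\mathrm q_1n_x+\mathrm q_2n_y=0$ on $\partial\Omega\times[0,T]$. $\mathcal V_\Omega=\{(h,\mathrm q_1,\mathrm q_2)\in H^1(\Omega\times[0,T])^3:\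 \mathrm q_1n_x+\mathrm q_2n_y=0\text{ on }\partial\Omega\times[0,T]\}$. $\mathcal W_\Omega$ is the set of $(\mathrm p_1,\mathrm p_2,\mathrm p_3)\in H^1(\Omega\times[0,T])^3$ satisfying the two boundary conditions on $\partial\Omega\times[0,T]$ displayed at the end of the claim, together with the final condition that the function vanishes at $t=T$. Adjoint states are sought in $\mathcal W_\Omega$. Lagrangian: for $\varphi=(\varphi_1,\varphi_2,\varphi_3)\in\mathcal V_\Omega$ and $\Phi=(\phi_1,\phi_2,\phi_3)\in\mathcal W_\Omega$, $$\mathcal L(0,\varphi,\Phi)=\int_0^T\!\!\int_\Omega\sum_{i=1}^3\big(|\nabla\varphi_i|^2+|\varphi_i-u_{id}|^2\big)-\int_0^T\!\!\int_\Omega\Big(\sum_{i=1}^3\varphi_i\,\partial_t\phi_i+\varphi_2\,\partial_x\phi_1+\varphi_3\,\partial_y\phi_1\Big)-\int_\Omega\big(h_0\phi_1+\mathrm q_{10}\phi_2+\mathrm q_{20}\phi_3\big)(x,0)\,dx$$ $$-\int_0^T\!\!\int_\Omega\Big[\Big(\frac{\varphi_2^2}{\varphi_1}+\frac g2\varphi_1^2\Big)\partial_x\phi_2+\frac{\varphi_2\varphi_3}{\varphi_1}\big(\partial_y\phi_2+\partial_x\phi_3\big)+\Big(\frac{\varphi_3^2}{\varphi_1}+\frac g2\varphi_1^2\Big)\partial_y\phi_3\Big]+\int_0^T\!\!\int_\Omega g\varphi_1\big(\phi_2\,\partial_x\psi+\phi_3\,\partial_y\psi\big).$$ $d_\varphi\mathcal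 L(0,\varphi,\Phi;\varphi')=\lim_{\theta\to0^+}\theta^{-1}[\mathcal L(0,\varphi+\theta\varphi',\Phi)-\mathcal L(0,\varphi,\Phi)]$ is the directional derivative in the variable $\varphi$. "Strong form" means the pointwise system obtained from the weak equation by spatial integration by parts of the terms $2\nabla h\cdot\nabla\varphi_1'$, $2\nabla \mathrm q_1\cdot\nabla\varphi_2'$, $2\nabla\mathrm q_2\cdot\nabla\varphi_3'$.
   Formalization: The water height h is assumed bounded below by a positive constant and directions φ' are essentially bounded, so that L is defined near U; strong form implies the adjoint equation only when L is defined and the boundary term from integrating by parts vanishes (false otherwise). *)

theory Defs
  imports "HOL-Analysis.Analysis"
begin

type_synonym plane = "real \<times> real"
type_synonym spacetime = "plane \<times> real"
type_synonym field = "spacetime \<Rightarrow> real ^ 3"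

text \<open>A point of space-time is \<open>((x, y), t)\<close>. A state \<open>(h, q\<^sub>1, q\<^sub>2)\<close>, an adjoint state
  \<open>(p\<^sub>1, p\<^sub>2, p\<^sub>3)\<close> and a direction are functions into \<open>real ^ 3\<close>.\<close>

definition cmp :: "('a \<Rightarrow> real ^ 3) \<Rightarrow> 3 \<Rightarrow> 'a \<Rightarrow> real" where
  "cmp U i = (\<lambda>z. U z $ i)"

text \<open>Integrals and function spaces over \<open>\<Omega> \<times> [0,T]\<close> are taken over the open cylinder,
  which differs from it by a null set and carries the test functions.\<close>

definition cyl :: "plane set \<Rightarrow> real \<Rightarrow> spacetime set" where
  "cyl \<Omega> T = \<Omega> \<times> {0<..<T}"

definition ex :: spacetime where "ex = ((1, 0), 0)"
definition ey :: spacetime where "ey = ((0, 1), 0)"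
definition et :: spacetime where "et = ((0, 0), 1)"


section \<open>Regular sets\<close>

text \<open>Class \<open>C\<^sup>1\<close>: locally \<open>\<Omega>\<close> is a strict sublevel set \<open>{\<rho> < 0}\<close> of a \<open>C\<^sup>1\<close> function
  without critical points. This determines the outward unit normal \<open>n\<close> on the boundary;
  the values of \<open>n\<close> elsewhere are irrelevant.\<close>

definition regular_domain :: "plane set \<Rightarrow> (plane \<Rightarrow> plane) \<Rightarrow> bool" where
  "regular_domain \<Omega> n \<longleftrightarrow> open \<Omega> \<and> \<Omega> \<noteq> {} \<and>
     (\<forall>z\<in>frontier \<Omega>. \<exists>W \<rho> G. open W \<and> z \<in> W \<and>
        (\<forall>x\<in>W. (\<rho> has_derivative (\<lambda>v. G x \<bullet> v)) (at x)) \<and>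
        continuous_on W G \<and> (\<forall>x\<in>W. G x \<noteq> 0) \<and>
        \<Omega> \<inter> W = {x \<in> W. \<rho> x < (0::real)} \<and>
        n z = G z /\<^sub>R norm (G z))"


section \<open>Weak derivatives and Sobolev functions\<close>

primrec Ck :: "nat \<Rightarrow> ('a::euclidean_space \<Rightarrow> real) \<Rightarrow> bool" where
  "Ck 0 f \<longleftrightarrow> continuous_on UNIV f"
| "Ck (Suc k) f \<longleftrightarrow> (\<forall>x. f differentiable (at x)) \<and>
     (\<forall>b\<in>Basis. Ck k (\<lambda>x. frechet_derivative f (at x) b))"

definition test_functions :: "'a::euclidean_space set \<Rightarrow> ('a \<Rightarrow> real) set" where
  "test_functions S = {\<eta>. (\<forall>k. Ck k \<eta>) \<and> (\<exists>K. compact K \<and> K \<subseteq> S \<and> (\<forall>z. z \<notin> K \<longrightarrow> \<eta> z = 0))}"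

abbreviation pd :: "'a::euclidean_space \<Rightarrow> ('a \<Rightarrow> real) \<Rightarrow> 'a \<Rightarrow> real" where
  "pd b f \<equiv> (\<lambda>z. frechet_derivative f (at z) b)"

definition loc_integrable :: "'a::euclidean_space set \<Rightarrow> ('a \<Rightarrow> real) \<Rightarrow> bool" where
  "loc_integrable S u \<longleftrightarrow> (\<forall>K. compact K \<and> K \<subseteq> S \<longrightarrow> integrable (lebesgue_on K) u)"

definition L2 :: "'a::euclidean_space set \<Rightarrow> ('a \<Rightarrow> real) \<Rightarrow> bool" where
  "L2 S u \<longleftrightarrow> u \<in> borel_measurable (lebesgue_on S) \<and> integrable (lebesgue_on S) (\<lambda>z. (u z)\<^sup>2)"

definition has_weak_partial ::
    "'a::euclidean_space set \<Rightarrow> 'a \<Rightarrow> ('a \<Rightarrow> real) \<Rightarrow> ('a \<Rightarrow> real) \<Rightarrow> bool" where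
  "has_weak_partial S b u v \<longleftrightarrow> loc_integrable S u \<and> loc_integrable S v \<and>
     (\<forall>\<eta>\<in>test_functions S.
        (\<integral>z. u z * pd b \<eta> z \<partial>lebesgue_on S) = - (\<integral>z. v z * \<eta> z \<partial>lebesgue_on S))"

definition weakly_differentiable :: "'a::euclidean_space set \<Rightarrow> 'a \<Rightarrow> ('a \<Rightarrow> real) \<Rightarrow> bool" where
  "weakly_differentiable S b u \<longleftrightarrow> (\<exists>v. has_weak_partial S b u v)"

text \<open>A representative of the weak derivative, meaningful only for weakly differentiable functions.
  Representatives agree almost everywhere on \<open>S\<close>.\<close>

definition wpd :: "'a::euclidean_space set \<Rightarrow> 'a \<Rightarrow> ('a \<Rightarrow> real) \<Rightarrow> 'a \<Rightarrow> real" where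
  "wpd S b u = (SOME v. has_weak_partial S b u v)"

definition H1 :: "'a::euclidean_space set \<Rightarrow> ('a \<Rightarrow> real) \<Rightarrow> bool" where
  "H1 S u \<longleftrightarrow> L2 S u \<and> (\<forall>b\<in>Basis. \<exists>v. L2 S v \<and> has_weak_partial S b u v)"

text \<open>The Laplacian acts on the space variables only. It is a weak Laplacian given by a locally
  integrable function, hence a pointwise almost everywhere defined object; for functions
  of class \<open>C\<^sup>2\<close> in space it is the classical one.\<close>

definition has_weak_laplacian ::
    "spacetime set \<Rightarrow> (spacetime \<Rightarrow> real) \<Rightarrow> (spacetime \<Rightarrow> real) \<Rightarrow> bool" where
  "has_weak_laplacian S u v \<longleftrightarrow> loc_integrable S u \<and> loc_integrable S v \<and>
     (\<forall>\<eta>\<in>test_functions S.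
        (\<integral>z. u z * (pd ex (pd ex \<eta>) z + pd ey (pd ey \<eta>) z) \<partial>lebesgue_on S)
          = (\<integral>z. v z * \<eta> z \<partial>lebesgue_on S))"

definition wlap :: "spacetime set \<Rightarrow> (spacetime \<Rightarrow> real) \<Rightarrow> spacetime \<Rightarrow> real" where
  "wlap S u = (SOME v. has_weak_laplacian S u v)"


section \<open>Traces\<close>

text \<open>The value at a boundary point \<open>z\<close> of the trace of \<open>u\<close> is the limit of averages over
  \<open>S \<inter> B(z, r)\<close>. For a Sobolev function on a Lipschitz set this limit exists for almost every
  boundary point, with respect to surface measure, and equals the trace.\<close>

definition has_trace ::
    "'a::euclidean_space set \<Rightarrow> ('a \<Rightarrow> real) \<Rightarrow> 'a \<Rightarrow> real \<Rightarrow> bool" where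
  "has_trace S u z a \<longleftrightarrow>
     (\<forall>\<^sub>F r in at_right 0. integrable (lebesgue_on (S \<inter> ball z r)) u) \<and>
     ((\<lambda>r. (\<integral>w. \<bar>u w - a\<bar> \<partial>lebesgue_on (S \<inter> ball z r)) / measure lebesgue (S \<inter> ball z r))
        \<longlongrightarrow> 0) (at_right 0)"

definition trace_value :: "'a::euclidean_space set \<Rightarrow> ('a \<Rightarrow> real) \<Rightarrow> 'a \<Rightarrow> real" where
  "trace_value S u z = (THE a. has_trace S u z a)"

text \<open>Null sets of the two-dimensional Hausdorff measure, that is, of surface measure on the
  lateral boundary. Boundedness is required because \<open>diameter\<close> is unspecified on unbounded sets;
  restricting to small diameters would not change the null sets.\<close>

definition surface_null :: "spacetime set \<Rightarrow> bool" where
  "surface_null N \<longleftrightarrow> (\<forall>\<epsilon>>0. \<exists>C :: nat \<Rightarrow> spacetime set.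
     N \<subseteq> (\<Union>i. C i) \<and> (\<forall>i. bounded (C i)) \<and>
     summable (\<lambda>i. (diameter (C i))\<^sup>2) \<and> (\<Sum>i. (diameter (C i))\<^sup>2) < \<epsilon>)"

definition ae_lateral :: "plane set \<Rightarrow> real \<Rightarrow> (plane \<Rightarrow> real \<Rightarrow> bool) \<Rightarrow> bool" where
  "ae_lateral \<Omega> T Q \<longleftrightarrow>
     surface_null {(x, t). x \<in> frontier \<Omega> \<and> t \<in> {0..T} \<and> \<not> Q x t}"

text \<open>\<open>a n\<^sub>x + b n\<^sub>y = 0\<close> on the lateral boundary.\<close>

definition no_normal_flux ::
    "plane set \<Rightarrow> real \<Rightarrow> (plane \<Rightarrow> plane) \<Rightarrow> (spacetime \<Rightarrow> real) \<Rightarrow> (spacetime \<Rightarrow> real) \<Rightarrow> bool" where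
  "no_normal_flux \<Omega> T n a b \<longleftrightarrow> ae_lateral \<Omega> T (\<lambda>x t. \<exists>\<alpha> \<beta>.
     has_trace (cyl \<Omega> T) a (x, t) \<alpha> \<and> has_trace (cyl \<Omega> T) b (x, t) \<beta> \<and>
     \<alpha> * fst (n x) + \<beta> * snd (n x) = 0)"

definition momentum_flux_condition ::
    "plane set \<Rightarrow> real \<Rightarrow> (plane \<Rightarrow> plane) \<Rightarrow> real \<Rightarrow> field \<Rightarrow> field \<Rightarrow> bool" where
  "momentum_flux_condition \<Omega> T n g U P \<longleftrightarrow> ae_lateral \<Omega> T (\<lambda>x t. \<exists>h q1 q2 p2 p3.
     has_trace (cyl \<Omega> T) (cmp U 1) (x, t) h \<and>
     has_trace (cyl \<Omega> T) (cmp U 2) (x, t) q1 \<and>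
     has_trace (cyl \<Omega> T) (cmp U 3) (x, t) q2 \<and>
     has_trace (cyl \<Omega> T) (cmp P 2) (x, t) p2 \<and>
     has_trace (cyl \<Omega> T) (cmp P 3) (x, t) p3 \<and>
     (q1\<^sup>2 / h + g / 2 * h\<^sup>2) * p2 * fst (n x) + q1 * q2 / h * p2 * snd (n x)
       + q1 * q2 / h * p3 * fst (n x) + (q2\<^sup>2 / h + g / 2 * h\<^sup>2) * p3 * snd (n x) = 0)"

text \<open>\<open>U(\<cdot>, s) = U0\<close> in \<open>\<Omega>\<close>, for \<open>s = 0\<close> or \<open>s = T\<close>.\<close>

definition time_value :: "plane set \<Rightarrow> real \<Rightarrow> field \<Rightarrow> real \<Rightarrow> (plane \<Rightarrow> real ^ 3) \<Rightarrow> bool" where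
  "time_value \<Omega> T U s U0 \<longleftrightarrow>
     (AE x in lebesgue_on \<Omega>. \<forall>i. has_trace (cyl \<Omega> T) (cmp U i) (x, s) (U0 x $ i))"


section \<open>State space, adjoint space and shallow water system\<close>

definition V_space :: "plane set \<Rightarrow> real \<Rightarrow> (plane \<Rightarrow> plane) \<Rightarrow> field set" where
  "V_space \<Omega> T n = {U. (\<forall>i. H1 (cyl \<Omega> T) (cmp U i)) \<and> no_normal_flux \<Omega> T n (cmp U 2) (cmp U 3)}"

definition W_space ::
    "plane set \<Rightarrow> real \<Rightarrow> (plane \<Rightarrow> plane) \<Rightarrow> real \<Rightarrow> field \<Rightarrow> field set" where
  "W_space \<Omega> T n g U = {P. (\<forall>i. H1 (cyl \<Omega> T) (cmp P i)) \<and>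
     no_normal_flux \<Omega> T n (cmp P 2) (cmp P 3) \<and>
     momentum_flux_condition \<Omega> T n g U P \<and>
     time_value \<Omega> T P T (\<lambda>_. 0)}"

definition solves_shallow_water ::
    "plane set \<Rightarrow> real \<Rightarrow> (plane \<Rightarrow> plane) \<Rightarrow> real \<Rightarrow> (plane \<Rightarrow> real) \<Rightarrow> (plane \<Rightarrow> real ^ 3) \<Rightarrow> field \<Rightarrow> bool"
  where
  "solves_shallow_water \<Omega> T n g \<psi> U0 U \<longleftrightarrow>
    (let S = cyl \<Omega> T; h = cmp U 1; q1 = cmp U 2; q2 = cmp U 3;
         F11 = (\<lambda>z. (q1 z)\<^sup>2 / h z + g / 2 * (h z)\<^sup>2);
         F12 = (\<lambda>z. q1 z * q2 z / h z);
         F22 = (\<lambda>z. (q2 z)\<^sup>2 / h z + g / 2 * (h z)\<^sup>2)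
     in U \<in> V_space \<Omega> T n \<and>
        weakly_differentiable S ex F11 \<and> weakly_differentiable S ey F12 \<and>
        weakly_differentiable S ex F12 \<and> weakly_differentiable S ey F22 \<and>
        (AE z in lebesgue_on S. wpd S et h z + wpd S ex q1 z + wpd S ey q2 z = 0) \<and>
        (AE z in lebesgue_on S. wpd S et q1 z + wpd S ex F11 z + wpd S ey F12 z
            + g * h z * pd (1, 0) \<psi> (fst z) = 0) \<and>
        (AE z in lebesgue_on S. wpd S et q2 z + wpd S ex F12 z + wpd S ey F22 z
            + g * h z * pd (0, 1) \<psi> (fst z) = 0) \<and>
        time_value \<Omega> T U 0 U0)"


section \<open>Objective, Lagrangian and adjoint equation\<close>

definition objective :: "plane set \<Rightarrow> real \<Rightarrow> field \<Rightarrow> field \<Rightarrow> real" where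
  "objective \<Omega> T Ud U = (let S = cyl \<Omega> T in
     (\<integral>z. (\<Sum>i\<in>UNIV. (wpd S ex (cmp U i) z)\<^sup>2 + (wpd S ey (cmp U i) z)\<^sup>2) \<partial>lebesgue_on S)
   + (\<integral>z. (\<Sum>i\<in>UNIV. (cmp U i z - cmp Ud i z)\<^sup>2) \<partial>lebesgue_on S))"

definition lagrangian ::
    "plane set \<Rightarrow> real \<Rightarrow> real \<Rightarrow> (plane \<Rightarrow> real) \<Rightarrow> (plane \<Rightarrow> real ^ 3) \<Rightarrow> field
      \<Rightarrow> field \<Rightarrow> field \<Rightarrow> real" where
  "lagrangian \<Omega> T g \<psi> U0 Ud \<phi> \<Phi> =
    (let S = cyl \<Omega> T; a = cmp \<phi> 1; b = cmp \<phi> 2; c = cmp \<phi> 3;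
         p1 = cmp \<Phi> 1; p2 = cmp \<Phi> 2; p3 = cmp \<Phi> 3
     in objective \<Omega> T Ud \<phi>
      - (\<integral>z. (\<Sum>i\<in>UNIV. cmp \<phi> i z * wpd S et (cmp \<Phi> i) z)
              + b z * wpd S ex p1 z + c z * wpd S ey p1 z \<partial>lebesgue_on S)
      - (\<integral>x. (\<Sum>i\<in>UNIV. cmp U0 i x * trace_value S (cmp \<Phi> i) (x, 0)) \<partial>lebesgue_on \<Omega>)
      - (\<integral>z. ((b z)\<^sup>2 / a z + g / 2 * (a z)\<^sup>2) * wpd S ex p2 z
              + b z * c z / a z * (wpd S ey p2 z + wpd S ex p3 z)
              + ((c z)\<^sup>2 / a z + g / 2 * (a z)\<^sup>2) * wpd S ey p3 z \<partial>lebesgue_on S)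
      + (\<integral>z. g * a z * (p2 z * pd (1, 0) \<psi> (fst z) + p3 z * pd (0, 1) \<psi> (fst z)) \<partial>lebesgue_on S))"

text \<open>Bochner integrals of non-integrable functions are \<open>0\<close> by convention, so that existence of the
  integrals in the Lagrangian has to be expressed separately. The terms coming from the
  objective always exist on the state space when \<open>Ud\<close> is square integrable.\<close>

definition lagrangian_defined ::
    "plane set \<Rightarrow> real \<Rightarrow> (plane \<Rightarrow> real) \<Rightarrow> (plane \<Rightarrow> real ^ 3) \<Rightarrow> field \<Rightarrow> field \<Rightarrow> bool" where
  "lagrangian_defined \<Omega> T \<psi> U0 \<phi> \<Phi> \<longleftrightarrow>
    (let S = cyl \<Omega> T; a = cmp \<phi> 1; b = cmp \<phi> 2; c = cmp \<phi> 3;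
         p1 = cmp \<Phi> 1; p2 = cmp \<Phi> 2; p3 = cmp \<Phi> 3; M = lebesgue_on S
     in (\<forall>i. integrable M (\<lambda>z. cmp \<phi> i z * wpd S et (cmp \<Phi> i) z)) \<and>
        integrable M (\<lambda>z. b z * wpd S ex p1 z) \<and>
        integrable M (\<lambda>z. c z * wpd S ey p1 z) \<and>
        (\<forall>i. integrable (lebesgue_on \<Omega>) (\<lambda>x. cmp U0 i x * trace_value S (cmp \<Phi> i) (x, 0))) \<and>
        integrable M (\<lambda>z. (b z)\<^sup>2 / a z * wpd S ex p2 z) \<and>
        integrable M (\<lambda>z. (a z)\<^sup>2 * wpd S ex p2 z) \<and>
        integrable M (\<lambda>z. b z * c z / a z * (wpd S ey p2 z + wpd S ex p3 z)) \<and>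
        integrable M (\<lambda>z. (c z)\<^sup>2 / a z * wpd S ey p3 z) \<and>
        integrable M (\<lambda>z. (a z)\<^sup>2 * wpd S ey p3 z) \<and>
        integrable M (\<lambda>z. a z * (p2 z * pd (1, 0) \<psi> (fst z) + p3 z * pd (0, 1) \<psi> (fst z))))"

definition lagrangian_has_dir_deriv ::
    "plane set \<Rightarrow> real \<Rightarrow> real \<Rightarrow> (plane \<Rightarrow> real) \<Rightarrow> (plane \<Rightarrow> real ^ 3) \<Rightarrow> field
      \<Rightarrow> field \<Rightarrow> field \<Rightarrow> field \<Rightarrow> real \<Rightarrow> bool" where
  "lagrangian_has_dir_deriv \<Omega> T g \<psi> U0 Ud U P \<phi>' d \<longleftrightarrow>
     lagrangian_defined \<Omega> T \<psi> U0 U P \<and>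
     (\<forall>\<^sub>F \<theta> in at_right 0. lagrangian_defined \<Omega> T \<psi> U0 (\<lambda>z. U z + \<theta> *\<^sub>R \<phi>' z) P) \<and>
     ((\<lambda>\<theta>. (lagrangian \<Omega> T g \<psi> U0 Ud (\<lambda>z. U z + \<theta> *\<^sub>R \<phi>' z) P - lagrangian \<Omega> T g \<psi> U0 Ud U P) / \<theta>)
        \<longlongrightarrow> d) (at_right 0)"

definition ess_bounded :: "spacetime set \<Rightarrow> field \<Rightarrow> bool" where
  "ess_bounded S \<phi> \<longleftrightarrow> (\<exists>M. AE z in lebesgue_on S. norm (\<phi> z) \<le> M)"

text \<open>Directions are the essentially bounded elements of the state space. For unbounded
  \<open>\<phi>'\<close> the perturbed depth \<open>h + \<theta> \<phi>'\<^sub>1\<close> may vanish inside the cylinder for every \<open>\<theta> > 0\<close>, and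
  then the Lagrangian, which contains \<open>1 / \<phi>\<^sub>1\<close>, is not defined near \<open>U\<close>. The bounded
  elements determine the equation. As a hypothesis, this is weaker than the requirement
  that the derivative exist and vanish in every direction of the state space.\<close>

definition adjoint_equation ::
    "plane set \<Rightarrow> real \<Rightarrow> (plane \<Rightarrow> plane) \<Rightarrow> real \<Rightarrow> (plane \<Rightarrow> real) \<Rightarrow> (plane \<Rightarrow> real ^ 3) \<Rightarrow> field
      \<Rightarrow> field \<Rightarrow> field \<Rightarrow> bool" where
  "adjoint_equation \<Omega> T n g \<psi> U0 Ud U P \<longleftrightarrow>
     (\<forall>\<phi>'\<in>V_space \<Omega> T n. ess_bounded (cyl \<Omega> T) \<phi>' \<longrightarrow>
        lagrangian_has_dir_deriv \<Omega> T g \<psi> U0 Ud U P \<phi>' 0)"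

definition strong_adjoint_system ::
    "plane set \<Rightarrow> real \<Rightarrow> real \<Rightarrow> (plane \<Rightarrow> real) \<Rightarrow> field \<Rightarrow> field \<Rightarrow> field \<Rightarrow> bool" where
  "strong_adjoint_system \<Omega> T g \<psi> Ud U P \<longleftrightarrow>
    (let S = cyl \<Omega> T; h = cmp U 1; q1 = cmp U 2; q2 = cmp U 3;
         p1 = cmp P 1; p2 = cmp P 2; p3 = cmp P 3
     in (\<forall>i. \<exists>v. has_weak_laplacian S (cmp U i) v) \<and>
        (AE z in lebesgue_on S.
           - wpd S et p1 z
           + wpd S ex p2 z * ((q1 z)\<^sup>2 / (h z)\<^sup>2 - g * h z)
           + wpd S ey p2 z * (q1 z * q2 z / (h z)\<^sup>2)
           + g * pd (1, 0) \<psi> (fst z) * p2 z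
           + wpd S ex p3 z * (q1 z * q2 z / (h z)\<^sup>2)
           + g * pd (0, 1) \<psi> (fst z) * p3 z
           + wpd S ey p3 z * ((q2 z)\<^sup>2 / (h z)\<^sup>2 - g * h z)
           = 2 * wlap S h z - 2 * (h z - cmp Ud 1 z)) \<and>
        (AE z in lebesgue_on S.
           - wpd S et p2 z - wpd S ex p1 z
           - 2 * wpd S ex p2 z * (q1 z / h z)
           - wpd S ey p2 z * (q2 z / h z)
           - wpd S ex p3 z * (q2 z / h z)
           = 2 * wlap S q1 z - 2 * (q1 z - cmp Ud 2 z)) \<and>
        (AE z in lebesgue_on S.
           - wpd S et p3 z - wpd S ey p1 z
           - wpd S ey p2 z * (q1 z / h z)
           - 2 * wpd S ey p3 z * (q2 z / h z)
           - wpd S ex p3 z * (q1 z / h z)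
           = 2 * wlap S q2 z - 2 * (q2 z - cmp Ud 3 z)))"

text \<open>Spatial integration by parts of \<open>2 \<nabla>U\<^sub>i \<cdot> \<nabla>\<phi>'\<^sub>i\<close> produces a lateral boundary term with the
  normal derivatives of \<open>U\<close>. It vanishes for compactly supported directions, but
  not for all directions; this predicate says that it does.\<close>

definition no_boundary_term :: "plane set \<Rightarrow> real \<Rightarrow> (plane \<Rightarrow> plane) \<Rightarrow> field \<Rightarrow> bool" where
  "no_boundary_term \<Omega> T n U \<longleftrightarrow> (let S = cyl \<Omega> T in
     \<forall>\<phi>'\<in>V_space \<Omega> T n. ess_bounded S \<phi>' \<longrightarrow>
       (\<integral>z. (\<Sum>i\<in>UNIV. wpd S ex (cmp U i) z * wpd S ex (cmp \<phi>' i) z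
                      + wpd S ey (cmp U i) z * wpd S ey (cmp \<phi>' i) z
                      + wlap S (cmp U i) z * cmp \<phi>' i z) \<partial>lebesgue_on S) = 0)"

end

theory Submission
  imports Defs
begin

text \<open>The one-sided derivative of the Lagrangian in a bounded direction \<open>V\<close> is computed by dominated
  convergence: the depth is bounded below, so for small \<open>\<theta>\<close> the difference quotients of
  \<open>\<phi>\<^sub>i \<phi>\<^sub>j / \<phi>\<^sub>1\<close> are bounded by products that are integrable because the Lagrangian is defined.
  The result is \<open>\<integral> \<Sum>\<^sub>i 2 \<nabla>U\<^sub>i \<cdot> \<nabla>V\<^sub>i + V\<^sub>i R\<^sub>i\<close> with \<open>R\<^sub>i\<close> locally integrable. Test functions are admissible
  directions, and for them the vanishing of the derivative says that \<open>R\<^sub>i / 2\<close> is the weak Laplacian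
  of \<open>U\<^sub>i\<close>, which is the strong system. Conversely, under the strong system the derivative is twice the
  integral whose vanishing is the absence of a boundary term.

  Weak derivatives of sums and of test functions are identified almost everywhere by the fundamental
  lemma of the calculus of variations.\<close>

section \<open>Smooth functions with support in a box\<close>

text \<open>The fluxes in the Lagrangian are products of two state components over the depth with a
  derivative of the adjoint state. Their integrability at \<open>U\<close> comes only from
  \<open>lagrangian_defined\<close>, without a Sobolev embedding, and for the mixed flux only with
  \<open>wpd S ey p2 + wpd S ex p3\<close> as weight. So the increment of a quotient is arranged
  such that, apart from bounded factors, it contains only this base value and products of two L2
  functions.

  A second obstacle is that \<open>wpd\<close> and \<open>wlap\<close> are choices among functions
  that agree almost everywhere. The gradient of \<open>U + \<theta> V\<close> is chosen anew for
  every \<theta>, with an exceptional null set depending on \<theta>. Such identities are therefore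
  used inside integrals at fixed \<theta>, before any limit is taken.

  Compactly supported directions satisfy the boundary condition of the state space trivially, so the
  strong equations come out without boundary terms. The converse meets every bounded direction,
  which is where the lateral term has to vanish.\<close>

definition flat_exp :: "nat \<Rightarrow> real \<Rightarrow> real" where
  "flat_exp m x = (if x > 0 then exp (- 1 / x) / x ^ m else 0)"

text \<open>Substituting the reciprocal of \<open>x\<close> turns this into the decay of a power
  against the exponential at infinity.\<close>

lemma flat_exp_over_power_tendsto_0: "((\<lambda>x. exp (- 1 / x) / x ^ m) \<longlongrightarrow> (0::real)) (at_right 0)"
proof -
  have "((\<lambda>x. (inverse x) ^ m / exp (inverse x)) \<longlongrightarrow> (0::real)) (at_right 0)"
    using tendsto_power_div_exp_0 filterlim_inverse_at_top_right by (rule filterlim_compose)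
  then show ?thesis
    by (simp add: exp_minus divide_simps mult.commute)
qed

text \<open>The powers in the denominator close the family under differentiation: each derivative is
  a combination of two other members. This is what makes an induction over the order of
  differentiability possible, including at the gluing point 0.\<close>

lemma flat_exp_has_derivative:
  "(flat_exp m has_real_derivative flat_exp (m + 2) x - real m * flat_exp (m + 1) x) (at x)"
proof -
  consider "x > 0" | "x < 0" | "x = 0" by linarith
  then show ?thesis
  proof cases
    case 1
    have "((\<lambda>x. exp (- 1 / x) / x ^ m) has_real_derivative
        flat_exp (m + 2) x - real m * flat_exp (m + 1) x) (at x)"
    proof -
      have alg: "(E * (1 / x\<^sup>2) * X - E * (r * X / x)) / (X * X) = E / (X * x\<^sup>2) - r * (E / (X * x))"
        if "X \<noteq> 0" for E X r :: real
        using 1 that by (simp add: divide_simps power2_eq_square) (simp add: algebra_simps)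
      have pow: "real m * x ^ (m - Suc 0) = real m * x ^ m / x"
        using 1 by (cases m) auto
      have "((\<lambda>x. exp (- 1 / x)) has_real_derivative exp (- 1 / x) * (1 / x\<^sup>2)) (at x)"
        using 1 by (auto intro!: derivative_eq_intros simp: power2_eq_square)
      from DERIV_divide[OF this DERIV_pow[of m x]] 1
      have der: "((\<lambda>x. exp (- 1 / x) / x ^ m) has_real_derivative
          (exp (- 1 / x) * (1 / x\<^sup>2) * x ^ m - exp (- 1 / x) * (real m * x ^ m / x)) / (x ^ m * x ^ m)) (at x)"
        unfolding pow by simp
      have eq: "(exp (- 1 / x) * (1 / x\<^sup>2) * x ^ m - exp (- 1 / x) * (real m * x ^ m / x)) / (x ^ m * x ^ m)
          = flat_exp (m + 2) x - real m * flat_exp (m + 1) x"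
        unfolding flat_exp_def if_P[OF 1] power_add power_one_right
        using 1 by (intro alg) simp
      from der show ?thesis
        unfolding eq .
    qed
    moreover have ev: "\<forall>\<^sub>F y in nhds x. flat_exp m y = exp (- 1 / y) / y ^ m"
      using eventually_nhds_in_open[of "{0<..}" x] 1
      by (auto elim!: eventually_mono simp: flat_exp_def)
    ultimately show ?thesis
      by (simp only: DERIV_cong_ev[OF refl ev refl])
  next
    case 2
    have "((\<lambda>x. 0) has_real_derivative flat_exp (m + 2) x - real m * flat_exp (m + 1) x) (at x)"
      using 2 by (simp add: flat_exp_def)
    moreover have ev: "\<forall>\<^sub>F y in nhds x. flat_exp m y = 0"
      using eventually_nhds_in_open[of "{..<0}" x] 2
      by (auto elim!: eventually_mono simp: flat_exp_def)
    ultimately show ?thesis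
      by (simp only: DERIV_cong_ev[OF refl ev refl])
  next
    case 3
    \<comment> \<open>The difference quotient at 0 vanishes on the left. On the right it is the same
      expression with exponent \<open>Suc m\<close>.\<close>
    have "((\<lambda>y. flat_exp m y / y) \<longlongrightarrow> 0) (at 0)"
    proof (rule filterlim_split_at)
      show "((\<lambda>y. flat_exp m y / y) \<longlongrightarrow> 0) (at_left 0)"
        by (rule tendsto_eventually) (auto simp: flat_exp_def eventually_at_filter)
      have "\<forall>\<^sub>F y in at_right 0. exp (- 1 / y) / y ^ Suc m = flat_exp m y / y"
        by (auto simp: flat_exp_def eventually_at_filter)
      then show "((\<lambda>y. flat_exp m y / y) \<longlongrightarrow> 0) (at_right 0)"
        by (rule Lim_transform_eventually[OF flat_exp_over_power_tendsto_0])
    qed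
    with 3 show ?thesis
      by (simp add: has_field_derivative_iff flat_exp_def)
  qed
qed

lemma has_derivative_imp_pd: "(f has_derivative f') (at z) \<Longrightarrow> pd b f z = f' b"
  by (metis frechet_derivative_at)

text \<open>The product rule leaves one factor undifferentiated, and the induction in
  \<open>Ck_mult\<close> has to lower the order of that factor.\<close>

lemma Ck_Suc_imp_Ck: "Ck (Suc k) f \<Longrightarrow> Ck k f"
proof (induction k arbitrary: f)
  case 0
  then show ?case
    by (auto intro!: differentiable_imp_continuous_on simp: differentiable_on_def
        intro: differentiable_at_withinI)
qed auto

lemma Ck_const: "Ck k (\<lambda>_. c)"
  by (induction k arbitrary: c) (auto simp: frechet_derivative_const)

lemma Ck_add: "Ck k f \<Longrightarrow> Ck k g \<Longrightarrow> Ck k (\<lambda>z. f z + g z)"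
proof (induction k arbitrary: f g)
  case (Suc k)
  have "pd b (\<lambda>z. f z + g z) = (\<lambda>z. pd b f z + pd b g z)" for b
    using Suc.prems by (auto simp: frechet_derivative_works
        intro!: has_derivative_imp_pd derivative_eq_intros)
  with Suc show ?case by (auto simp: differentiable_add)
qed (auto intro: continuous_intros)

lemma Ck_mult: "Ck k f \<Longrightarrow> Ck k g \<Longrightarrow> Ck k (\<lambda>z. f z * g z)"
proof (induction k arbitrary: f g)
  case (Suc k)
  have "pd b (\<lambda>z. f z * g z) = (\<lambda>z. f z * pd b g z + pd b f z * g z)" for b
    using Suc.prems by (auto simp: frechet_derivative_works
        intro!: has_derivative_imp_pd derivative_eq_intros)
  then have "Ck k (pd b (\<lambda>z. f z * g z))" if "b \<in> Basis" for b
    using Suc.prems that Ck_Suc_imp_Ck[of k f] Ck_Suc_imp_Ck[of k g]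
    by (auto intro!: Ck_add Suc.IH)
  with Suc.prems show ?case by (auto intro: differentiable_mult)
qed (auto intro: continuous_intros)

lemma Ck_prod: "(\<And>i. i \<in> A \<Longrightarrow> Ck k (f i)) \<Longrightarrow> Ck k (\<lambda>z. \<Prod>i\<in>A. f i z)"
  by (induction A rule: infinite_finite_induct) (auto intro: Ck_const Ck_mult)

text \<open>The induction keeps \<open>m\<close> arbitrary because differentiation raises it. Affine
  arguments cover both kinds of factor in the bumps below, the distances to the lower and to the
  upper faces of a box.\<close>

lemma Ck_flat_exp_affine: "Ck k (\<lambda>z. flat_exp m (\<alpha> \<bullet> z + \<beta>))"
proof (induction k arbitrary: m)
  case 0
  have "continuous_on UNIV (flat_exp m)"
    using flat_exp_has_derivative by (intro DERIV_continuous_on) (auto intro: DERIV_subset)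
  then show ?case
    by (auto intro!: continuous_on_compose2[of UNIV "flat_exp m"] continuous_intros)
next
  case (Suc k)
  have d: "((\<lambda>z. flat_exp m (\<alpha> \<bullet> z + \<beta>)) has_derivative
      (\<lambda>v. (flat_exp (m + 2) (\<alpha> \<bullet> z + \<beta>) - real m * flat_exp (m + 1) (\<alpha> \<bullet> z + \<beta>)) * (\<alpha> \<bullet> v))) (at z)"
    for z
    by (rule has_derivative_compose[where g = "flat_exp m", OF _
          flat_exp_has_derivative[unfolded has_field_derivative_def]])
       (auto intro!: derivative_eq_intros)
  have "Ck k (\<lambda>z. (flat_exp (m + 2) (\<alpha> \<bullet> z + \<beta>) + (- real m) * flat_exp (m + 1) (\<alpha> \<bullet> z + \<beta>)) * (\<alpha> \<bullet> b))" for b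
    by (intro Ck_mult Ck_add Ck_const Suc.IH)
  then show ?case
    by (auto simp: has_derivative_imp_pd[OF d] differentiableI[OF d])
qed

text \<open>The factor \<open>k\<close> makes these functions converge to the indicator function of the box.\<close>

definition box_bump :: "'a::euclidean_space \<Rightarrow> 'a \<Rightarrow> nat \<Rightarrow> 'a \<Rightarrow> real" where
  "box_bump a b k z = (\<Prod>i\<in>Basis. flat_exp 0 (real k * (z \<bullet> i - a \<bullet> i)) * flat_exp 0 (real k * (b \<bullet> i - z \<bullet> i)))"

lemma Ck_box_bump: "Ck j (box_bump a b k)"
proof -
  have "Ck j (\<lambda>z. \<Prod>i\<in>Basis. flat_exp 0 ((real k *\<^sub>R i) \<bullet> z + (- real k * (a \<bullet> i)))
      * flat_exp 0 (((- real k) *\<^sub>R i) \<bullet> z + real k * (b \<bullet> i)))"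
    by (intro Ck_prod Ck_mult Ck_flat_exp_affine)
  also have "(\<lambda>z. \<Prod>i\<in>Basis. flat_exp 0 ((real k *\<^sub>R i) \<bullet> z + (- real k * (a \<bullet> i)))
      * flat_exp 0 (((- real k) *\<^sub>R i) \<bullet> z + real k * (b \<bullet> i))) = box_bump a b k"
    by (auto simp: fun_eq_iff box_bump_def algebra_simps inner_commute)
  finally show ?thesis .
qed

lemma box_bump_eq_0: "z \<notin> box a b \<Longrightarrow> box_bump a b k z = 0"
proof -
  assume "z \<notin> box a b"
  then obtain i where "i \<in> Basis" "z \<bullet> i \<le> a \<bullet> i \<or> b \<bullet> i \<le> z \<bullet> i"
    by (auto simp: mem_box not_less)
  then show ?thesis
    unfolding box_bump_def
    by (intro prod_zero bexI[of _ i]) (auto simp: flat_exp_def zero_less_mult_iff)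
qed

lemma box_bump_bounds: "0 \<le> box_bump a b k z" "box_bump a b k z \<le> 1"
  unfolding box_bump_def
  by (auto intro!: prod_nonneg prod_le_1 mult_le_one simp: flat_exp_def)

lemma box_bump_tendsto: "(\<lambda>k. box_bump a b k z) \<longlonglongrightarrow> indicator (box a b) z"
proof (cases "z \<in> box a b")
  case True
  have *: "(\<lambda>k. flat_exp 0 (real k * s)) \<longlonglongrightarrow> 1" if "s > 0" for s :: real
  proof -
    have "(\<lambda>k. exp (- ((1 / s) / real k))) \<longlonglongrightarrow> exp (- 0)"
      by (intro tendsto_intros lim_const_over_n)
    then have "(\<lambda>k. exp (- ((1 / s) / real k))) \<longlonglongrightarrow> 1"
      by simp
    \<comment> \<open>Index 0 must be left out: there division by zero makes the left side 1, while
      \<open>flat_exp 0 0\<close> is 0.\<close>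
    moreover have "\<forall>\<^sub>F k in sequentially. exp (- ((1 / s) / real k)) = flat_exp 0 (real k * s)"
      by (rule eventually_sequentiallyI[of 1]) (use that in \<open>auto simp: flat_exp_def field_simps\<close>)
    ultimately show ?thesis
      by (rule Lim_transform_eventually)
  qed
  have "(\<lambda>k. box_bump a b k z) \<longlonglongrightarrow> (\<Prod>i\<in>(Basis::'a set). 1 * 1)"
    unfolding box_bump_def using True by (intro tendsto_intros *) (auto simp: mem_box)
  with True show ?thesis by simp
qed (simp add: box_bump_eq_0)

lemma box_bump_test_function: "cbox a b \<subseteq> S \<Longrightarrow> box_bump a b k \<in> test_functions S"
  unfolding test_functions_def
  using box_bump_eq_0[of _ a b k] box_subset_cbox[of a b]
  by (auto intro!: Ck_box_bump exI[of _ "cbox a b"])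

section \<open>Uniqueness of weak derivatives\<close>

text \<open>Open boxes are stable under intersection and generate the Borel sets, so Dynkin's
  argument extends the vanishing from boxes to all Borel sets. Then \<open>w\<close> and 0 are
  densities of the same set function.\<close>

lemma AE_eq_0_if_box_integrals_0:
  fixes w :: "'a::euclidean_space \<Rightarrow> real"
  assumes w: "integrable lborel w"
    and box0: "\<And>a b. (\<integral>z. indicator (box a b) z * w z \<partial>lborel) = 0"
  shows "AE z in lborel. w z = 0"
proof -
  have int: "integrable lborel (\<lambda>z. indicator A z * w z)" if "A \<in> sets borel" for A
    using that w integrable_mult_indicator[of A lborel w] by simp
  \<comment> \<open>The complement step of the induction needs the integral over the whole space,
    obtained by exhausting it with centred cubes.\<close>
  have total: "(\<integral>z. w z \<partial>lborel) = 0"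
  proof (rule LIMSEQ_unique)
    let ?B = "\<lambda>k. box (- (real k *\<^sub>R One)) (real k *\<^sub>R One) :: 'a set"
    show "(\<lambda>k. \<integral>z. indicator (?B k) z * w z \<partial>lborel) \<longlonglongrightarrow> 0"
      by (simp add: box0)
    show "(\<lambda>k. \<integral>z. indicator (?B k) z * w z \<partial>lborel) \<longlonglongrightarrow> (\<integral>z. w z \<partial>lborel)"
    proof (rule integral_dominated_convergence[where w = "\<lambda>z. \<bar>w z\<bar>"])
      have "\<forall>\<^sub>F k in sequentially. indicator (?B k) z * w z = w z" for z
      proof -
        obtain m :: nat where m: "norm z < real m" using reals_Archimedean2 by blast
        show ?thesis
        proof (rule eventually_sequentiallyI[of m])
          fix k assume "m \<le> k"
          have "z \<in> ?B k"
            unfolding mem_box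
          proof
            fix i :: 'a assume "i \<in> Basis"
            then have "\<bar>z \<bullet> i\<bar> < real k"
              using Basis_le_norm[of i z] m \<open>m \<le> k\<close> by linarith
            with \<open>i \<in> Basis\<close> show "- (real k *\<^sub>R One) \<bullet> i < z \<bullet> i \<and> z \<bullet> i < (real k *\<^sub>R One) \<bullet> i"
              by auto
          qed
          then show "indicator (?B k) z * w z = w z" by simp
        qed
      qed
      then have "(\<lambda>k. indicator (?B k) z * w z) \<longlonglongrightarrow> w z" for z
        by (rule tendsto_eventually)
      then show "AE z in lborel. (\<lambda>k. indicator (?B k) z * w z) \<longlonglongrightarrow> w z"
        by simp
    qed (use w int in \<open>auto simp: indicator_def\<close>)
  qed
  have zero: "(\<integral>z. indicator A z * w z \<partial>lborel) = 0" if "A \<in> sets borel" for A :: "'a set"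
  proof -
    have st: "Int_stable (range (\<lambda>(a, b). box a b :: 'a set))"
      by (auto simp: Int_stable_def box_Int_box)
    have sub: "range (\<lambda>(a, b). box a b :: 'a set) \<subseteq> Pow UNIV" by simp
    have "A \<in> sigma_sets UNIV (range (\<lambda>(a, b). box a b :: 'a set))"
      using that by (simp add: borel_eq_box)
    with st sub show ?thesis
    proof (induction rule: sigma_sets_induct_disjoint[consumes 3, case_names basic empty compl union])
      case (compl A)
      then have A: "A \<in> sets borel" by (simp add: borel_eq_box)
      have "(\<integral>z. indicator (UNIV - A) z * w z \<partial>lborel) = (\<integral>z. w z - indicator A z * w z \<partial>lborel)"
        by (intro Bochner_Integration.integral_cong) (auto simp: indicator_def)
      also have "\<dots> = 0"
        using compl int[OF A] w total by simp
      finally show ?case .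
    next
      case (union A)
      then have A: "A i \<in> sets borel" for i by (auto simp: borel_eq_box)
      have "(LINT z:(\<Union>i. A i)|lborel. w z) = (\<Sum>i. (LINT z:(A i)|lborel. w z))"
        using A int[of "\<Union>i. A i"] union(1)
        by (intro lebesgue_integral_countable_add) (auto simp: set_integrable_def disjoint_family_on_def)
      with union(3) show ?case by (simp add: set_lebesgue_integral_def)
    qed (use box0 in auto)
  qed
  have "AE z in lborel. w z = (\<lambda>_. 0) z"
    by (rule density_unique_real) (use w zero in \<open>auto simp: set_lebesgue_integral_def\<close>)
  then show ?thesis by simp
qed

text \<open>Moves integrals of compactly supported functions between the support, \<open>S\<close>
  and the whole space.\<close>

lemma lebesgue_on_vanishing_outside:
  fixes f :: "'a::euclidean_space \<Rightarrow> real"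
  assumes "S \<in> sets lebesgue" "\<And>z. z \<notin> S \<Longrightarrow> f z = 0"
  shows "(\<integral>z. f z \<partial>lebesgue_on S) = (\<integral>z. f z \<partial>lebesgue)"
    and "integrable (lebesgue_on S) f \<longleftrightarrow> integrable lebesgue f"
proof -
  have "(\<lambda>z. if z \<in> S then f z else 0) = f"
    using assms by auto
  with Lebesgue_Measure.integral_restrict_UNIV[OF assms(1), of f]
    Lebesgue_Measure.integrable_restrict_UNIV[OF assms(1), of f]
  show "(\<integral>z. f z \<partial>lebesgue_on S) = (\<integral>z. f z \<partial>lebesgue)"
    "integrable (lebesgue_on S) f \<longleftrightarrow> integrable lebesgue f"
    by simp_all
qed

section \<open>Calculus of test functions\<close>

lemma test_functionE:
  assumes "\<eta> \<in> test_functions S"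
  obtains K where "compact K" "K \<subseteq> S" "\<And>z. z \<notin> K \<Longrightarrow> \<eta> z = 0"
  using assms unfolding test_functions_def by blast

lemma test_function_Ck: "\<eta> \<in> test_functions S \<Longrightarrow> Ck k \<eta>"
  by (auto simp: test_functions_def)

lemma test_function_continuous: "\<eta> \<in> test_functions S \<Longrightarrow> continuous_on A \<eta>"
  using test_function_Ck[of \<eta> S 0] by (auto intro: continuous_on_subset)

lemma test_function_has_derivative:
  "\<eta> \<in> test_functions S \<Longrightarrow> (\<eta> has_derivative frechet_derivative \<eta> (at z)) (at z)"
  using test_function_Ck[of \<eta> S "Suc 0"] by (simp add: frechet_derivative_works)

lemma test_function_outside: "\<eta> \<in> test_functions S \<Longrightarrow> z \<notin> S \<Longrightarrow> \<eta> z = 0"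
  by (auto simp: test_functions_def)

text \<open>The complement of the compact set \<open>K\<close> is open and \<eta> is 0 on it, so the
  same \<open>K\<close> serves for the derivative.\<close>

lemma test_function_pd:
  assumes "\<eta> \<in> test_functions S" "b \<in> Basis"
  shows "pd b \<eta> \<in> test_functions S"
proof -
  obtain K where K: "compact K" "K \<subseteq> S" "\<And>z. z \<notin> K \<Longrightarrow> \<eta> z = 0"
    using test_functionE[OF assms(1)] by blast
  have "pd b \<eta> z = 0" if "z \<notin> K" for z
  proof -
    have "\<forall>\<^sub>F y in nhds z. 0 = \<eta> y"
      using eventually_nhds_in_open[of "- K" z] K that compact_imp_closed[of K]
      by (auto simp: open_Compl elim!: eventually_mono)
    then have "(\<eta> has_derivative (\<lambda>_. 0)) (at z)"
      by (intro has_derivative_transform_eventually[of "\<lambda>_. 0" "\<lambda>_. 0" z UNIV \<eta>])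
         (auto simp: eventually_at_filter K(3) that elim: eventually_mono)
    then show ?thesis by (simp add: has_derivative_imp_pd)
  qed
  moreover have "Ck k (pd b \<eta>)" for k
    using test_function_Ck[OF assms(1), of "Suc k"] assms(2) by simp
  ultimately show ?thesis
    using K by (auto simp: test_functions_def)
qed

lemma test_function_mult:
  assumes "\<eta> \<in> test_functions S" "\<zeta> \<in> test_functions S"
  shows "(\<lambda>z. \<eta> z * \<zeta> z) \<in> test_functions S"
proof -
  obtain K where "compact K" "K \<subseteq> S" "\<And>z. z \<notin> K \<Longrightarrow> \<eta> z = 0"
    using test_functionE[OF assms(1)] by blast
  then show ?thesis
    using assms unfolding test_functions_def by (auto intro!: Ck_mult exI[of _ K])
qed

lemma zero_test_function: "(\<lambda>_. 0) \<in> test_functions S"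
  unfolding test_functions_def by (auto intro!: Ck_const exI[of _ "{}"])

lemma test_function_bounded:
  assumes "\<eta> \<in> test_functions S"
  obtains B where "B \<ge> 0" "\<And>z. \<bar>\<eta> z\<bar> \<le> B"
proof -
  obtain K where K: "compact K" "K \<subseteq> S" "\<And>z. z \<notin> K \<Longrightarrow> \<eta> z = 0"
    using test_functionE[OF assms] by blast
  have "bounded (\<eta> ` K)"
    using K(1) test_function_continuous[OF assms] by (intro compact_imp_bounded compact_continuous_image)
  then obtain B where B: "\<And>z. z \<in> K \<Longrightarrow> \<bar>\<eta> z\<bar> \<le> B"
    by (auto simp: bounded_iff)
  have "\<bar>\<eta> z\<bar> \<le> max B 0" for z
    using B K(3) by (cases "z \<in> K") (auto simp: le_max_iff_disj)
  then show ?thesis using that[of "max B 0"] by auto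
qed

lemma test_function_measurable: "\<eta> \<in> test_functions S \<Longrightarrow> \<eta> \<in> borel_measurable (lebesgue_on A)"
  using borel_measurable_continuous_onI[OF test_function_continuous[of \<eta> S UNIV]]
  by (auto intro!: measurable_restrict_space1 measurable_completion)

text \<open>On the compact set \<open>K\<close> the function \<open>u\<close> is integrable and
  \<eta> bounded. Extension by zero carries the product to the whole space, and restriction brings
  it back to \<open>S\<close>.\<close>

lemma loc_integrable_mult_test_function:
  assumes u: "loc_integrable S u" and S: "S \<in> sets lebesgue" and \<eta>: "\<eta> \<in> test_functions S"
  shows "integrable (lebesgue_on S) (\<lambda>z. u z * \<eta> z)"
proof -
  obtain K where K: "compact K" "K \<subseteq> S" "\<And>z. z \<notin> K \<Longrightarrow> \<eta> z = 0"
    using test_functionE[OF \<eta>] by blast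
  obtain B where B: "B \<ge> 0" "\<And>z. \<bar>\<eta> z\<bar> \<le> B"
    using test_function_bounded[OF \<eta>] by metis
  have uK: "integrable (lebesgue_on K) u"
    using u K by (simp add: loc_integrable_def)
  have "integrable (lebesgue_on K) (\<lambda>z. u z * \<eta> z)"
  proof (rule Bochner_Integration.integrable_bound)
    show "integrable (lebesgue_on K) (\<lambda>z. B * u z)"
      using uK by simp
    show "(\<lambda>z. u z * \<eta> z) \<in> borel_measurable (lebesgue_on K)"
      using uK test_function_measurable[OF \<eta>] by measurable
    show "AE z in lebesgue_on K. norm (u z * \<eta> z) \<le> norm (B * u z)"
      using B mult_right_mono[OF B(2), of "\<bar>u _\<bar>"] by (auto simp: abs_mult mult.commute)
  qed
  moreover have "K \<in> sets lebesgue"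
    using K(1) by (simp add: lmeasurable_compact fmeasurableD)
  ultimately have "integrable lebesgue (\<lambda>z. u z * \<eta> z)"
    using K(3) by (subst (asm) lebesgue_on_vanishing_outside(2)) auto
  then show ?thesis
    using S test_function_outside[OF \<eta>] by (subst lebesgue_on_vanishing_outside(2)) auto
qed

section \<open>The fundamental lemma of the calculus of variations\<close>

lemma indicator_box_measurable: "indicator (box a b) \<in> borel_measurable lebesgue"
  by (intro measurable_completion) simp

text \<open>The bumps are test functions with values in [0,1] that converge to the indicator of the
  open box, so dominated convergence applies. The majorant is \<bar>v\<bar> cut off to the closed
  box, where local integrability makes it integrable.\<close>

lemma loc_integrable_integral_box_0:
  assumes S: "open S" and v: "loc_integrable S v"
    and zero: "\<And>\<eta>. \<eta> \<in> test_functions S \<Longrightarrow> (\<integral>z. v z * \<eta> z \<partial>lebesgue_on S) = 0"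
    and box: "cbox a b \<subseteq> S"
  shows "(\<integral>z. indicator (box a b) z * v z \<partial>lebesgue) = 0"
proof -
  have vi: "integrable lebesgue (\<lambda>z. indicator (cbox a b) z * v z)"
  proof -
    have "integrable (lebesgue_on (cbox a b)) v"
      using v box by (simp add: loc_integrable_def)
    then have "integrable lebesgue (\<lambda>z. if z \<in> cbox a b then v z else 0)"
      by (subst Lebesgue_Measure.integrable_restrict_UNIV) auto
    also have "(\<lambda>z. if z \<in> cbox a b then v z else 0) = (\<lambda>z. indicator (cbox a b) z * v z)"
      by auto
    finally show ?thesis .
  qed
  have bz: "indicator (cbox a b) z * v z * box_bump a b k z = v z * box_bump a b k z" for z k
    using box_bump_eq_0[of z a b k] box_subset_cbox[of a b] by (auto simp: indicator_def)
  have "(\<lambda>k. \<integral>z. indicator (cbox a b) z * v z * box_bump a b k z \<partial>lebesgue) \<longlonglongrightarrow>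
      (\<integral>z. indicator (cbox a b) z * v z * indicator (box a b) z \<partial>lebesgue)"
  proof (rule integral_dominated_convergence[where w = "\<lambda>z. \<bar>indicator (cbox a b) z * v z\<bar>"])
    show "AE z in lebesgue. norm (indicator (cbox a b) z * v z * box_bump a b k z)
        \<le> \<bar>indicator (cbox a b) z * v z\<bar>" for k
      using mult_left_mono[OF box_bump_bounds(2)[of a b k], of "\<bar>indicator (cbox a b) _ * v _\<bar>"]
      by (auto simp: abs_mult box_bump_bounds(1))
    show "(\<lambda>z. indicator (cbox a b) z * v z * box_bump a b k z) \<in> borel_measurable lebesgue" for k
      using borel_measurable_times[OF borel_measurable_integrable[OF vi]]
        test_function_measurable[OF box_bump_test_function[OF box, of k], of UNIV] by simp
    show "(\<lambda>z. indicator (cbox a b) z * v z * indicator (box a b) z) \<in> borel_measurable lebesgue"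
      by (intro borel_measurable_times[OF borel_measurable_integrable[OF vi]] indicator_box_measurable)
    show "AE z in lebesgue. (\<lambda>k. indicator (cbox a b) z * v z * box_bump a b k z)
        \<longlonglongrightarrow> indicator (cbox a b) z * v z * indicator (box a b) z"
      by (intro AE_I2 tendsto_intros box_bump_tendsto)
  qed (use vi in simp)
  moreover have "(\<integral>z. indicator (cbox a b) z * v z * box_bump a b k z \<partial>lebesgue) = 0" for k
  proof -
    have "(\<integral>z. v z * box_bump a b k z \<partial>lebesgue) = (\<integral>z. v z * box_bump a b k z \<partial>lebesgue_on S)"
      using S test_function_outside[OF box_bump_test_function[OF box]]
      by (intro lebesgue_on_vanishing_outside(1)[symmetric]) auto
    then show ?thesis
      using zero[OF box_bump_test_function[OF box]] by (simp add: bz)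
  qed
  ultimately have "(\<integral>z. indicator (cbox a b) z * v z * indicator (box a b) z \<partial>lebesgue) = 0"
    by (simp add: LIMSEQ_const_iff)
  moreover have "indicator (cbox a b) z * v z * indicator (box a b) z = indicator (box a b) z * v z" for z
    using box_subset_cbox[of a b] by (auto simp: indicator_def)
  ultimately show ?thesis by simp
qed

lemma open_eq_countable_Union_cboxes:
  fixes S :: "'a::euclidean_space set"
  assumes "open S"
  shows "\<exists>D. countable D \<and> D \<subseteq> Pow S \<and> (\<forall>X\<in>D. \<exists>a b. X = cbox a b) \<and> \<Union>D = S"
proof (rule open_countable_Union_open_cbox[OF assms])
  fix D :: "'a set set"
  assume "countable D" "D \<subseteq> Pow S" "\<And>X. X \<in> D \<Longrightarrow> \<exists>a b. X = cbox a b" "\<Union>D = S"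
  then show ?thesis by (intro exI[of _ D]) simp
qed

text \<open>As \<open>v\<close> need not be integrable on \<open>S\<close>, it is cut off to one
  closed box inside \<open>S\<close> at a time. The cutoff has zero integral over every open box
  because two open boxes meet in an open box. Countably many closed boxes exhaust \<open>S\<close>,
  so the exceptional sets remain null.\<close>

lemma fundamental_lemma:
  fixes S :: "'a::euclidean_space set"
  assumes S: "open S" and v: "loc_integrable S v"
    and zero: "\<And>\<eta>. \<eta> \<in> test_functions S \<Longrightarrow> (\<integral>z. v z * \<eta> z \<partial>lebesgue_on S) = 0"
  shows "AE z in lebesgue_on S. v z = 0"
proof -
  have X: "AE z in lebesgue. z \<in> cbox c d \<longrightarrow> v z = 0" if cd: "cbox c d \<subseteq> S" for c d :: 'a
  proof -
    let ?w = "\<lambda>z. if z \<in> cbox c d then v z else 0"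
    have "integrable (lebesgue_on (cbox c d)) v"
      using v cd by (simp add: loc_integrable_def)
    then have w: "integrable lebesgue ?w"
      by (subst Lebesgue_Measure.integrable_restrict_UNIV) auto
    \<comment> \<open>The criterion on box integrals is stated for \<open>lborel\<close>, while the
      cutoff is only Lebesgue measurable.\<close>
    obtain w' where w': "w' \<in> borel_measurable lborel" "AE z in lborel. ?w z = w' z"
      using completion_ex_borel_measurable_real[OF borel_measurable_integrable[OF w]] by blast
    have AEw: "AE z in lebesgue. ?w z = w' z"
      using w'(2) by (rule AE_completion)
    have "integrable lebesgue w'"
      using w' w AEw by (subst integrable_cong_AE[of w' lebesgue ?w]) (auto intro: measurable_completion)
    then have int': "integrable lborel w'"
      using w'(1) by (simp add: integrable_completion)
    have "AE z in lborel. w' z = 0"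
    proof (rule AE_eq_0_if_box_integrals_0[OF int'])
      fix a b :: 'a
      obtain a' b' where ab: "box a b \<inter> box c d = box a' b'"
        unfolding box_Int_box by blast
      \<comment> \<open>The boundary of a box is negligible, so the cutoff may be replaced by the
        one to the open box, whose intersection with \<open>box a b\<close> is again an open
        box.\<close>
      have fr: "AE z in lebesgue. z \<notin> cbox c d - box c d"
        using negligible_frontier_interval[of c d] unfolding negligible_iff_null_sets by (rule AE_not_in)
      have "(\<integral>z. indicator (box a b) z * w' z \<partial>lborel) = (\<integral>z. indicator (box a b) z * w' z \<partial>lebesgue)"
        using w'(1) by (intro integral_completion[symmetric]) auto
      also have "\<dots> = (\<integral>z. indicator (box a b) z * (if z \<in> box c d then v z else 0) \<partial>lebesgue)"
      proof (rule integral_cong_AE)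
        show "(\<lambda>z. indicator (box a b) z * w' z) \<in> borel_measurable lebesgue"
          using w'(1) by (intro measurable_completion) auto
        have "?w \<in> borel_measurable lebesgue" using w by simp
        then have "(\<lambda>z. indicator (box c d) z * ?w z) \<in> borel_measurable lebesgue"
          by (intro borel_measurable_times indicator_box_measurable)
        also have "(\<lambda>z. indicator (box c d) z * ?w z) = (\<lambda>z. if z \<in> box c d then v z else 0)"
          using box_subset_cbox[of c d] by (auto simp: fun_eq_iff indicator_def)
        finally show "(\<lambda>z. indicator (box a b) z * (if z \<in> box c d then v z else 0)) \<in> borel_measurable lebesgue"
          by (intro borel_measurable_times indicator_box_measurable)
        show "AE z in lebesgue. indicator (box a b) z * w' z = indicator (box a b) z * (if z \<in> box c d then v z else 0)"
          using AEw fr by eventually_elim (use box_subset_cbox[of c d] in auto)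
      qed
      also have "\<dots> = (\<integral>z. indicator (box a' b') z * v z \<partial>lebesgue)"
        by (intro Bochner_Integration.integral_cong) (auto simp: ab[symmetric] indicator_def)
      also have "\<dots> = 0"
      proof (cases "box a' b' = {}")
        case False
        \<comment> \<open>When the open box is empty, \<open>cbox a' b'\<close> need not be its
          closure and might leave \<open>S\<close>; that case is settled by the integral being
          trivially 0.\<close>
        then have "cbox a' b' = closure (box a' b')" by (simp add: closure_box)
        also have "\<dots> \<subseteq> cbox c d"
          using ab box_subset_cbox[of c d] by (intro closure_minimal) auto
        finally show ?thesis
          using cd by (intro loc_integrable_integral_box_0[OF S v zero]) auto
      qed simp
      finally show "(\<integral>z. indicator (box a b) z * w' z \<partial>lborel) = 0" .
    qed
    then have "AE z in lebesgue. w' z = 0" by (rule AE_completion)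
    with AEw show ?thesis by eventually_elim auto
  qed
  obtain D where D: "countable D" "D \<subseteq> Pow S" "\<forall>X\<in>D. \<exists>a b. X = cbox a b" "\<Union>D = S"
    using open_eq_countable_Union_cboxes[OF S] by blast
  have "AE z in lebesgue. \<forall>X\<in>D. z \<in> X \<longrightarrow> v z = 0"
    unfolding AE_ball_countable[OF D(1)]
  proof
    fix Y assume "Y \<in> D"
    then obtain c d where "Y = cbox c d" "cbox c d \<subseteq> S"
      using D(2,3) by fastforce
    then show "AE z in lebesgue. z \<in> Y \<longrightarrow> v z = 0"
      using X by simp
  qed
  then have "AE z in lebesgue. z \<in> S \<longrightarrow> v z = 0"
    using D(4) by (auto elim!: eventually_mono)
  then show ?thesis
    using S by (subst AE_restrict_space_iff) auto
qed

section \<open>Integration by parts, Sobolev regularity and traces of test functions\<close>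

lemma test_function_integrable:
  assumes "\<eta> \<in> test_functions S"
  shows "integrable lebesgue \<eta>"
proof -
  obtain K where K: "compact K" "K \<subseteq> S" "\<And>z. z \<notin> K \<Longrightarrow> \<eta> z = 0"
    using test_functionE[OF assms] by blast
  have "integrable lborel (\<lambda>z. indicator K z *\<^sub>R \<eta> z)"
    using K(1) test_function_continuous[OF assms] by (intro borel_integrable_compact)
  also have "(\<lambda>z. indicator K z *\<^sub>R \<eta> z) = \<eta>"
    using K(3) by (auto simp: fun_eq_iff indicator_def)
  finally show ?thesis
    by (subst integrable_completion) auto
qed

text \<open>Translation invariance: the difference quotients of \<open>\<eta>\<close> in direction \<open>b\<close> have integral \<open>0\<close>.\<close>

lemma integral_pd_test_function:
  fixes \<eta> :: "'a::euclidean_space \<Rightarrow> real"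
  assumes \<eta>: "\<eta> \<in> test_functions S" and b: "b \<in> Basis"
  shows "(\<integral>z. pd b \<eta> z \<partial>lebesgue) = 0"
proof -
  obtain K where K: "compact K" "K \<subseteq> S" "\<And>z. z \<notin> K \<Longrightarrow> \<eta> z = 0"
    using test_functionE[OF \<eta>] by blast
  obtain B where B: "B \<ge> 0" "\<And>z. \<bar>pd b \<eta> z\<bar> \<le> B"
    using test_function_bounded[OF test_function_pd[OF \<eta> b]] by metis
  have bor: "\<eta> \<in> borel_measurable lborel" "pd b \<eta> \<in> borel_measurable lborel"
    using borel_measurable_continuous_onI[OF test_function_continuous[OF \<eta>]]
      borel_measurable_continuous_onI[OF test_function_continuous[OF test_function_pd[OF \<eta> b]]] by simp_all
  have int: "integrable lborel \<eta>"
    using test_function_integrable[OF \<eta>] bor(1) by (simp add: integrable_completion)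
  have transl: "integrable lborel (\<lambda>z. \<eta> (c + z))" "(\<integral>z. \<eta> (c + z) \<partial>lborel) = (\<integral>z. \<eta> z \<partial>lborel)" for c
  proof -
    have "integrable (distr lborel borel ((+) c)) \<eta>"
      using int by (simp add: lborel_distr_plus)
    then show "integrable lborel (\<lambda>z. \<eta> (c + z))"
      by (subst (asm) integrable_distr_eq) (use bor in auto)
    have "(\<integral>z. \<eta> z \<partial>lborel) = (\<integral>z. \<eta> z \<partial>distr lborel borel ((+) c))"
      by (simp add: lborel_distr_plus)
    also have "\<dots> = (\<integral>z. \<eta> (c + z) \<partial>lborel)"
      by (subst integral_distr) (use bor in auto)
    finally show "(\<integral>z. \<eta> (c + z) \<partial>lborel) = (\<integral>z. \<eta> z \<partial>lborel)" by simp
  qed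
  define t where "t k = inverse (real (Suc k))" for k
  have t: "0 < t k" "t k \<le> 1" for k
    by (auto simp: t_def field_simps)
  define F where "F k z = (\<eta> (t k *\<^sub>R b + z) - \<eta> z) / t k" for k z
  \<comment> \<open>Since \<open>0 < t k \<le> 1\<close>, every difference quotient vanishes outside
    this compact set. A constant on it is thus an integrable majorant common to all
    \<open>k\<close>.\<close>
  define K1 where "K1 = (\<lambda>(x, s). x - s *\<^sub>R b) ` (K \<times> {0..1})"
  have K1: "compact K1"
    unfolding K1_def using K(1)
    by (intro compact_continuous_image compact_Times) (auto intro!: continuous_intros simp: case_prod_unfold)
  have line: "((\<lambda>s. \<eta> (s *\<^sub>R b + z)) has_real_derivative pd b \<eta> (s *\<^sub>R b + z)) (at s)" for s z
  proof -
    have "((\<lambda>s. \<eta> (s *\<^sub>R b + z)) has_derivative (\<lambda>r. frechet_derivative \<eta> (at (s *\<^sub>R b + z)) (r *\<^sub>R b))) (at s)"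
      by (rule has_derivative_compose[OF _ test_function_has_derivative[OF \<eta>]])
         (auto intro!: derivative_eq_intros)
    moreover have "frechet_derivative \<eta> (at y) (r *\<^sub>R b) = pd b \<eta> y * r" for r y
      using has_derivative_linear[OF test_function_has_derivative[OF \<eta>, of y]]
      by (simp add: linear_cmul)
    ultimately show ?thesis
      by (simp add: has_field_derivative_def)
  qed
  have "(\<lambda>k. \<integral>z. F k z \<partial>lborel) \<longlonglongrightarrow> (\<integral>z. pd b \<eta> z \<partial>lborel)"
  proof (rule integral_dominated_convergence[where w = "\<lambda>z. indicator K1 z *\<^sub>R B"])
    show "pd b \<eta> \<in> borel_measurable lborel" by (rule bor)
    show "F k \<in> borel_measurable lborel" for k
      using transl(1) int unfolding F_def by (intro borel_measurable_divide borel_measurable_diff) auto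
    show "integrable lborel (\<lambda>z. indicator K1 z *\<^sub>R B)"
      using K1 by (intro borel_integrable_compact) auto
    show "AE z in lborel. (\<lambda>k. F k z) \<longlonglongrightarrow> pd b \<eta> z"
    proof (rule AE_I2)
      fix z :: 'a
      have "((\<lambda>s. (\<eta> (s *\<^sub>R b + z) - \<eta> z) / s) \<longlongrightarrow> pd b \<eta> z) (at 0)"
        using line[of z 0] by (simp add: has_field_derivative_iff)
      moreover have "filterlim t (at 0) sequentially"
      proof -
        have "t \<longlonglongrightarrow> 0" unfolding t_def by (rule LIMSEQ_inverse_real_of_nat)
        with t(1) show ?thesis by (simp add: filterlim_at less_imp_neq[THEN not_sym])
      qed
      ultimately show "(\<lambda>k. F k z) \<longlonglongrightarrow> pd b \<eta> z"
        unfolding F_def by (rule filterlim_compose)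
    qed
    show "AE z in lborel. norm (F k z) \<le> indicator K1 z *\<^sub>R B" for k
    proof (rule AE_I2)
      fix z :: 'a
      show "norm (F k z) \<le> indicator K1 z *\<^sub>R B"
      proof (cases "z \<in> K1")
        case False
        have "t k *\<^sub>R b + z \<notin> K"
        proof
          assume "t k *\<^sub>R b + z \<in> K"
          with t[of k] have "(\<lambda>(x, s). x - s *\<^sub>R b) (t k *\<^sub>R b + z, t k) \<in> K1"
            unfolding K1_def by (intro imageI) auto
          with False show False by simp
        qed
        moreover have "z \<notin> K"
        proof
          assume "z \<in> K"
          then have "(\<lambda>(x, s). x - s *\<^sub>R b) (z, 0) \<in> K1"
            unfolding K1_def by (intro imageI) auto
          with False show False by simp
        qed
        ultimately show ?thesis by (simp add: F_def K(3) False)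
      next
        case True
        \<comment> \<open>The mean value theorem along the segment bounds the difference quotient by
          the supremum \<open>B\<close> of the partial derivative.\<close>
        obtain s where "\<eta> (t k *\<^sub>R b + z) - \<eta> (0 *\<^sub>R b + z) = (t k - 0) * pd b \<eta> (s *\<^sub>R b + z)"
          using MVT2[OF t(1)[of k] line[of z]] by blast
        then have "F k z = pd b \<eta> (s *\<^sub>R b + z)"
          using t(1)[of k] by (simp add: F_def)
        with B(2) True show ?thesis by simp
      qed
    qed
  qed
  moreover have "(\<integral>z. F k z \<partial>lborel) = 0" for k
    using transl[of "t k *\<^sub>R b"] int by (simp add: F_def)
  ultimately have "(\<integral>z. pd b \<eta> z \<partial>lborel) = 0"
    by (simp add: LIMSEQ_const_iff)
  then show ?thesis
    using bor(2) by (simp add: integral_completion)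
qed

text \<open>The product is again a test function, so the integral of its derivative vanishes, and
  the product rule splits that integral.\<close>

lemma test_function_integration_by_parts:
  fixes \<eta> :: "'a::euclidean_space \<Rightarrow> real"
  assumes "\<eta> \<in> test_functions S" "\<zeta> \<in> test_functions S" "b \<in> Basis" "open S"
  shows "(\<integral>z. \<eta> z * pd b \<zeta> z \<partial>lebesgue_on S) = - (\<integral>z. pd b \<eta> z * \<zeta> z \<partial>lebesgue_on S)"
proof -
  have S: "S \<in> sets lebesgue" using assms(4) by auto
  have m1: "(\<lambda>z. \<eta> z * pd b \<zeta> z) \<in> test_functions S" and m2: "(\<lambda>z. pd b \<eta> z * \<zeta> z) \<in> test_functions S"
    using assms by (auto intro!: test_function_mult test_function_pd)
  have d: "((\<lambda>z. \<eta> z * \<zeta> z) has_derivative (\<lambda>h. \<eta> z * frechet_derivative \<zeta> (at z) h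
      + frechet_derivative \<eta> (at z) h * \<zeta> z)) (at z)" for z
    using assms by (intro has_derivative_mult test_function_has_derivative)
  have "pd b (\<lambda>z. \<eta> z * \<zeta> z) = (\<lambda>z. \<eta> z * pd b \<zeta> z + pd b \<eta> z * \<zeta> z)"
    by (simp add: has_derivative_imp_pd[OF d])
  then have "(\<integral>z. \<eta> z * pd b \<zeta> z + pd b \<eta> z * \<zeta> z \<partial>lebesgue) = 0"
    using integral_pd_test_function[OF test_function_mult[OF assms(1,2)] assms(3)] by simp
  then show ?thesis
    using test_function_integrable[OF m1] test_function_integrable[OF m2]
      lebesgue_on_vanishing_outside(1)[OF S test_function_outside[OF m1]]
      lebesgue_on_vanishing_outside(1)[OF S test_function_outside[OF m2]]
    by simp
qed

lemma loc_integrable_test_function: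
  assumes "\<eta> \<in> test_functions S"
  shows "loc_integrable A \<eta>"
  unfolding loc_integrable_def
proof (intro allI impI)
  fix K assume "compact K \<and> K \<subseteq> A"
  then have K: "compact K" by simp
  then have "integrable lborel (\<lambda>z. indicator K z *\<^sub>R \<eta> z)"
    using test_function_continuous[OF assms] by (rule borel_integrable_compact)
  then have "integrable lebesgue (\<lambda>z. indicator K z *\<^sub>R \<eta> z)"
    by (subst integrable_completion) auto
  also have "(\<lambda>z. indicator K z *\<^sub>R \<eta> z) = (\<lambda>z. if z \<in> K then \<eta> z else 0)"
    by (auto simp: fun_eq_iff indicator_def)
  finally show "integrable (lebesgue_on K) \<eta>"
    using K by (subst (asm) Lebesgue_Measure.integrable_restrict_UNIV)
      (auto intro: fmeasurableD lmeasurable_compact)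
qed

lemma test_function_weak_partial:
  fixes \<eta> :: "'a::euclidean_space \<Rightarrow> real"
  assumes "\<eta> \<in> test_functions S" "b \<in> Basis" "open S"
  shows "has_weak_partial S b \<eta> (pd b \<eta>)"
  unfolding has_weak_partial_def
  using assms by (auto intro!: loc_integrable_test_function test_function_pd
      test_function_integration_by_parts)

lemma L2_test_function:
  assumes \<eta>: "\<eta> \<in> test_functions S" and S: "open S"
  shows "L2 S \<eta>"
proof -
  have m: "(\<lambda>z. \<eta> z * \<eta> z) \<in> test_functions S"
    using \<eta> by (intro test_function_mult)
  have "integrable (lebesgue_on S) (\<lambda>z. \<eta> z * \<eta> z)"
    using S test_function_integrable[OF m] test_function_outside[OF m]
    by (subst lebesgue_on_vanishing_outside(2)) auto
  then show ?thesis
    using test_function_measurable[OF \<eta>] by (simp add: L2_def power2_eq_square)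
qed

lemma H1_test_function:
  assumes "\<eta> \<in> test_functions S" "open S"
  shows "H1 S \<eta>"
  unfolding H1_def
  using assms L2_test_function test_function_weak_partial test_function_pd by blast

text \<open>The support has positive distance from \<open>z\<close>, so for small radii the
  integrand in the definition of the trace is 0.\<close>

lemma has_trace_test_function:
  fixes S :: "'a::euclidean_space set"
  assumes \<eta>: "\<eta> \<in> test_functions S" and z: "z \<notin> S"
  shows "has_trace S \<eta> z 0"
proof -
  obtain K where K: "compact K" "K \<subseteq> S" "\<And>y. y \<notin> K \<Longrightarrow> \<eta> y = 0"
    using test_functionE[OF \<eta>] by blast
  have "open (- K)" "z \<in> - K"
    using K z compact_imp_closed by (auto simp: open_Compl)
  then obtain e where e: "0 < e" "ball z e \<subseteq> - K"
    by (meson openE)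
  have vanish: "\<eta> y = 0" if "r < e" "y \<in> space (lebesgue_on (S \<inter> ball z r))" for r y
    using that e(2) by (intro K(3)) (auto simp: subset_iff)
  have ev: "\<forall>\<^sub>F r in at_right (0::real). r < e"
    using eventually_at_right_real[OF e(1)] by (auto elim!: eventually_mono)
  have "\<forall>\<^sub>F r in at_right 0. integrable (lebesgue_on (S \<inter> ball z r)) \<eta>"
    using ev by eventually_elim (subst Bochner_Integration.integrable_cong[OF refl vanish], auto)
  moreover have "((\<lambda>r. (\<integral>w. \<bar>\<eta> w - 0\<bar> \<partial>lebesgue_on (S \<inter> ball z r)) / measure lebesgue (S \<inter> ball z r)) \<longlongrightarrow> 0) (at_right 0)"
  proof (rule tendsto_eventually)
    show "\<forall>\<^sub>F r in at_right 0. (\<integral>w. \<bar>\<eta> w - 0\<bar> \<partial>lebesgue_on (S \<inter> ball z r)) / measure lebesgue (S \<inter> ball z r) = 0"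
      using ev
    proof eventually_elim
      case (elim r)
      have "(\<integral>w. \<bar>\<eta> w - 0\<bar> \<partial>lebesgue_on (S \<inter> ball z r)) = (\<integral>w. 0 \<partial>lebesgue_on (S \<inter> ball z r))"
        using vanish[OF elim] by (intro Bochner_Integration.integral_cong) auto
      then show ?case by simp
    qed
  qed
  ultimately show ?thesis
    unfolding has_trace_def by blast
qed

section \<open>Chosen representatives of weak derivatives and weak Laplacians\<close>

lemma weak_partial_unique:
  fixes S :: "'a::euclidean_space set"
  assumes S: "open S" and v: "has_weak_partial S b u v" and w: "has_weak_partial S b u w"
  shows "AE z in lebesgue_on S. v z = w z"
proof -
  have "AE z in lebesgue_on S. v z - w z = 0"
  proof (rule fundamental_lemma[OF S])
    show "loc_integrable S (\<lambda>z. v z - w z)"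
      using v w by (auto simp: has_weak_partial_def loc_integrable_def)
    fix \<eta> assume \<eta>: "\<eta> \<in> test_functions S"
    have "integrable (lebesgue_on S) (\<lambda>z. v z * \<eta> z)" "integrable (lebesgue_on S) (\<lambda>z. w z * \<eta> z)"
      using v w S \<eta> by (auto simp: has_weak_partial_def intro!: loc_integrable_mult_test_function)
    then show "(\<integral>z. (v z - w z) * \<eta> z \<partial>lebesgue_on S) = 0"
      using v w \<eta> by (simp add: has_weak_partial_def left_diff_distrib)
  qed
  then show ?thesis by (auto elim: eventually_mono)
qed

lemma weak_laplacian_unique:
  assumes S: "open S" and v: "has_weak_laplacian S u v" and w: "has_weak_laplacian S u w"
  shows "AE z in lebesgue_on S. v z = w z"
proof -
  have "AE z in lebesgue_on S. v z - w z = 0"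
  proof (rule fundamental_lemma[OF S])
    show "loc_integrable S (\<lambda>z. v z - w z)"
      using v w by (auto simp: has_weak_laplacian_def loc_integrable_def)
    fix \<eta> assume \<eta>: "\<eta> \<in> test_functions S"
    have "integrable (lebesgue_on S) (\<lambda>z. v z * \<eta> z)" "integrable (lebesgue_on S) (\<lambda>z. w z * \<eta> z)"
      using v w S \<eta> by (auto simp: has_weak_laplacian_def intro!: loc_integrable_mult_test_function)
    then show "(\<integral>z. (v z - w z) * \<eta> z \<partial>lebesgue_on S) = 0"
      using v w \<eta> by (simp add: has_weak_laplacian_def left_diff_distrib)
  qed
  then show ?thesis by (auto elim: eventually_mono)
qed

lemma has_weak_partial_wpd: "has_weak_partial S b u v \<Longrightarrow> has_weak_partial S b u (wpd S b u)"
  unfolding wpd_def by (rule someI[of "has_weak_partial S b u"])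

lemma wpd_AE_eq:
  "open S \<Longrightarrow> has_weak_partial S b u v \<Longrightarrow> AE z in lebesgue_on S. wpd S b u z = v z"
  using weak_partial_unique has_weak_partial_wpd by blast

lemma has_weak_laplacian_wlap: "has_weak_laplacian S u v \<Longrightarrow> has_weak_laplacian S u (wlap S u)"
  unfolding wlap_def by (rule someI[of "has_weak_laplacian S u"])

lemma wlap_AE_eq:
  "open S \<Longrightarrow> has_weak_laplacian S u v \<Longrightarrow> AE z in lebesgue_on S. wlap S u z = v z"
  using weak_laplacian_unique has_weak_laplacian_wlap by blast

text \<open>Used for the gradient of the perturbed state \<open>U + \<theta> V\<close> in the
  objective.\<close>

lemma has_weak_partial_add_scaled:
  assumes S: "open S" and b: "b \<in> Basis" and u: "has_weak_partial S b u v" and u': "has_weak_partial S b u' v'"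
  shows "has_weak_partial S b (\<lambda>z. u z + \<theta> * u' z) (\<lambda>z. v z + \<theta> * v' z)"
  unfolding has_weak_partial_def
proof (intro conjI ballI)
  show "loc_integrable S (\<lambda>z. u z + \<theta> * u' z)" "loc_integrable S (\<lambda>z. v z + \<theta> * v' z)"
    using u u' by (auto simp: has_weak_partial_def loc_integrable_def)
  fix \<eta> assume \<eta>: "\<eta> \<in> test_functions S"
  have i: "integrable (lebesgue_on S) (\<lambda>z. v z * \<eta> z)" "integrable (lebesgue_on S) (\<lambda>z. v' z * \<eta> z)"
    "integrable (lebesgue_on S) (\<lambda>z. u z * pd b \<eta> z)" "integrable (lebesgue_on S) (\<lambda>z. u' z * pd b \<eta> z)"
    using u u' S \<eta> test_function_pd[OF \<eta> b]
    by (auto simp: has_weak_partial_def intro!: loc_integrable_mult_test_function)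
  have "(\<integral>z. (u z + \<theta> * u' z) * pd b \<eta> z \<partial>lebesgue_on S)
      = (\<integral>z. u z * pd b \<eta> z \<partial>lebesgue_on S) + \<theta> * (\<integral>z. u' z * pd b \<eta> z \<partial>lebesgue_on S)"
    using i by (simp add: distrib_right mult.assoc)
  also have "\<dots> = - ((\<integral>z. v z * \<eta> z \<partial>lebesgue_on S) + \<theta> * (\<integral>z. v' z * \<eta> z \<partial>lebesgue_on S))"
    using u u' \<eta> by (simp add: has_weak_partial_def)
  also have "\<dots> = - (\<integral>z. (v z + \<theta> * v' z) * \<eta> z \<partial>lebesgue_on S)"
    using i by (simp add: distrib_right mult.assoc)
  finally show "(\<integral>z. (u z + \<theta> * u' z) * pd b \<eta> z \<partial>lebesgue_on S) = - (\<integral>z. (v z + \<theta> * v' z) * \<eta> z \<partial>lebesgue_on S)" .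
qed

lemma has_weak_partial_loc_integrable: "has_weak_partial S b u v \<Longrightarrow> loc_integrable S v"
  by (simp add: has_weak_partial_def)

text \<open>Integrability on each of countably many closed boxes covering \<open>S\<close> gives
  measurability piece by piece. For \<open>wpd\<close> and \<open>wlap\<close> local integrability
  is all that the choice guarantees.\<close>

lemma loc_integrable_measurable:
  fixes S :: "'a::euclidean_space set"
  assumes S: "open S" and v: "loc_integrable S v"
  shows "v \<in> borel_measurable (lebesgue_on S)"
proof -
  obtain D where D: "countable D" "D \<subseteq> Pow S" "\<forall>X\<in>D. \<exists>a b. X = cbox a b" "\<Union>D = S"
    using open_eq_countable_Union_cboxes[OF S] by blast
  show ?thesis
  proof (rule measurable_piecewise_restrict[OF D(1)])
    show "X \<inter> space (lebesgue_on S) \<in> sets (lebesgue_on S)" if "X \<in> D" for X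
      using that D S by (fastforce simp: sets_restrict_space_iff)
    show "space (lebesgue_on S) \<subseteq> \<Union>D"
      using D by simp
    fix X assume X: "X \<in> D"
    then have "compact X" "X \<subseteq> S" using D by (auto dest: D(3)[rule_format])
    then have "v \<in> borel_measurable (lebesgue_on X)"
      using v by (auto simp: loc_integrable_def)
    moreover have "restrict_space (lebesgue_on S) X = lebesgue_on X"
      using \<open>X \<subseteq> S\<close> S \<open>compact X\<close>
      by (subst restrict_restrict_space) (auto simp: Int_absorb1 intro: fmeasurableD lmeasurable_compact)
    ultimately show "v \<in> borel_measurable (restrict_space (lebesgue_on S) X)" by simp
  qed
qed

text \<open>\<open>H1\<close> only promises that some weak derivative is square integrable. The
  chosen one agrees with it almost everywhere and so inherits the property.\<close>

lemma H1_wpd: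
  assumes S: "open S" and u: "H1 S u" and b: "b \<in> Basis"
  shows "L2 S (wpd S b u)" "has_weak_partial S b u (wpd S b u)"
proof -
  obtain v where v: "L2 S v" "has_weak_partial S b u v"
    using u b by (auto simp: H1_def)
  show w: "has_weak_partial S b u (wpd S b u)"
    using has_weak_partial_wpd[OF v(2)] .
  have m: "wpd S b u \<in> borel_measurable (lebesgue_on S)"
    using loc_integrable_measurable[OF S has_weak_partial_loc_integrable[OF w]] .
  have "AE z in lebesgue_on S. (wpd S b u z)\<^sup>2 = (v z)\<^sup>2"
    using wpd_AE_eq[OF S v(2)] by eventually_elim simp
  moreover have "(\<lambda>z. (wpd S b u z)\<^sup>2) \<in> borel_measurable (lebesgue_on S)"
    using m by measurable
  moreover have "integrable (lebesgue_on S) (\<lambda>z. (v z)\<^sup>2)"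
    using v by (simp add: L2_def)
  ultimately have "integrable (lebesgue_on S) (\<lambda>z. (wpd S b u z)\<^sup>2)"
    using integrable_cong_AE_imp by (smt (verit) AE_cong)
  with m show "L2 S (wpd S b u)" by (simp add: L2_def)
qed

section \<open>Square integrability, local integrability and measurability\<close>

lemma L2_mult:
  assumes "L2 S u" "L2 S v"
  shows "integrable (lebesgue_on S) (\<lambda>z. u z * v z)"
proof (rule Bochner_Integration.integrable_bound)
  show "integrable (lebesgue_on S) (\<lambda>z. (u z)\<^sup>2 + (v z)\<^sup>2)"
    using assms by (simp add: L2_def)
  show "(\<lambda>z. u z * v z) \<in> borel_measurable (lebesgue_on S)"
    using assms by (auto simp: L2_def)
  have "\<bar>x * y\<bar> \<le> x\<^sup>2 + y\<^sup>2" for x y :: real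
    using sum_squares_bound[of "\<bar>x\<bar>" "\<bar>y\<bar>"] mult_nonneg_nonneg[of "\<bar>x\<bar>" "\<bar>y\<bar>"]
    unfolding abs_mult mult.assoc power2_abs by linarith
  then show "AE z in lebesgue_on S. norm (u z * v z) \<le> norm ((u z)\<^sup>2 + (v z)\<^sup>2)"
    by auto
qed

lemma L2_add:
  assumes "L2 S u" "L2 S v"
  shows "L2 S (\<lambda>z. u z + v z)"
  using assms L2_mult[OF assms] by (auto simp: L2_def power2_sum mult.assoc)

lemma L2_cmult: "L2 S u \<Longrightarrow> L2 S (\<lambda>z. c * u z)"
  by (auto simp: L2_def power_mult_distrib)

lemma L2_diff: "L2 S u \<Longrightarrow> L2 S v \<Longrightarrow> L2 S (\<lambda>z. u z - v z)"
  using L2_add[of S u "\<lambda>z. (- 1) * v z"] L2_cmult[of S v "- 1"] by simp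

lemma L2_bounded_mult:
  assumes "L2 S u" "v \<in> borel_measurable (lebesgue_on S)" "AE z in lebesgue_on S. \<bar>v z\<bar> \<le> B"
  shows "L2 S (\<lambda>z. u z * v z)"
  unfolding L2_def
proof
  show m: "(\<lambda>z. u z * v z) \<in> borel_measurable (lebesgue_on S)"
    using assms by (auto simp: L2_def)
  show "integrable (lebesgue_on S) (\<lambda>z. (u z * v z)\<^sup>2)"
  proof (rule Bochner_Integration.integrable_bound)
    show "integrable (lebesgue_on S) (\<lambda>z. (B * u z)\<^sup>2)"
      using L2_cmult[OF assms(1)] by (simp add: L2_def)
    show "AE z in lebesgue_on S. norm ((u z * v z)\<^sup>2) \<le> norm ((B * u z)\<^sup>2)"
      using assms(3)
    proof eventually_elim
      case (elim z)
      then have "\<bar>u z\<bar> * \<bar>v z\<bar> \<le> \<bar>u z\<bar> * \<bar>B\<bar>" by (intro mult_left_mono) auto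
      then show ?case
        by (simp add: abs_mult[symmetric] abs_le_square_iff mult.commute)
    qed
  qed (use m in measurable)
qed

text \<open>A compact set has finite measure, so the constant 1 is square integrable on it, and
  \<open>u\<close> is the product of \<open>u\<close> and 1.\<close>

lemma L2_loc_integrable:
  fixes S :: "'a::euclidean_space set"
  assumes "L2 S u" "S \<in> sets lebesgue"
  shows "loc_integrable S u"
  unfolding loc_integrable_def
proof (intro allI impI)
  fix K assume K: "compact K \<and> K \<subseteq> S"
  then have Ks: "K \<in> lmeasurable" by (simp add: lmeasurable_compact)
  have r: "lebesgue_on K = restrict_space (lebesgue_on S) K"
    using K Ks assms(2) by (subst restrict_restrict_space) (auto simp: Int_absorb1)
  have "L2 K u"
    unfolding L2_def r
    using assms K Ks by (auto simp: L2_def sets_restrict_space_iff measurable_restrict_space1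
        intro!: integrable_restrict_space[THEN iffD2] integrable_mult_indicator)
  moreover have "integrable (lebesgue_on K) (\<lambda>_. 1 :: real)"
    using finite_measure.integrable_const[OF finite_measure_lebesgue_on[OF Ks]] .
  then have "L2 K (\<lambda>_. 1)"
    by (simp add: L2_def)
  ultimately have "integrable (lebesgue_on K) (\<lambda>z. u z * 1)"
    by (rule L2_mult)
  then show "integrable (lebesgue_on K) u" by simp
qed

lemma integrable_loc_integrable:
  fixes S :: "'a::euclidean_space set"
  assumes "integrable (lebesgue_on S) u" "S \<in> sets lebesgue"
  shows "loc_integrable S u"
  unfolding loc_integrable_def
proof (intro allI impI)
  fix K assume K: "compact K \<and> K \<subseteq> S"
  then have Ks: "K \<in> lmeasurable" by (simp add: lmeasurable_compact)
  have r: "lebesgue_on K = restrict_space (lebesgue_on S) K"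
    using K Ks assms(2) by (subst restrict_restrict_space) (auto simp: Int_absorb1)
  show "integrable (lebesgue_on K) u"
    unfolding r
    using assms K Ks by (auto simp: sets_restrict_space_iff
        intro!: integrable_restrict_space[THEN iffD2] integrable_mult_indicator)
qed

text \<open>The bottom \<psi> is only differentiable, so its partial derivatives may be
  discontinuous. They are pointwise limits of continuous difference quotients.\<close>

lemma borel_measurable_pd:
  fixes f :: "'a::euclidean_space \<Rightarrow> real"
  assumes f: "\<And>x. f differentiable (at x)"
  shows "pd b f \<in> borel_measurable borel"
proof -
  define t where "t k = inverse (real (Suc k))" for k
  have "t \<longlonglongrightarrow> 0" unfolding t_def by (rule LIMSEQ_inverse_real_of_nat)
  moreover have "t k \<noteq> 0" for k by (simp add: t_def)
  ultimately have t: "filterlim t (at 0) sequentially"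
    by (simp add: filterlim_at)
  have c: "continuous_on UNIV f"
    using f by (simp add: continuous_at_imp_continuous_on differentiable_imp_continuous_within)
  have "continuous_on UNIV (\<lambda>x. f (t k *\<^sub>R b + x))" for k
    using c by (rule continuous_on_compose2) (auto intro!: continuous_intros)
  then have m: "(\<lambda>x. (f (t k *\<^sub>R b + x) - f x) / t k) \<in> borel_measurable borel" for k
    using c by (intro borel_measurable_continuous_onI continuous_on_divide continuous_on_diff)
      (simp_all add: t_def)
  have l: "(\<lambda>k. (f (t k *\<^sub>R b + x) - f x) / t k) \<longlonglongrightarrow> pd b f x" for x
  proof -
    have fx: "(f has_derivative frechet_derivative f (at x)) (at x)"
      using f by (simp add: frechet_derivative_works)
    have "((\<lambda>s. f (s *\<^sub>R b + x)) has_derivative (\<lambda>r. frechet_derivative f (at x) (r *\<^sub>R b))) (at 0)"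
      using fx by (intro has_derivative_compose[of "\<lambda>s. s *\<^sub>R b + x" "\<lambda>r. r *\<^sub>R b" 0 UNIV f "frechet_derivative f (at x)"])
        (auto intro!: derivative_eq_intros)
    moreover have "frechet_derivative f (at x) (r *\<^sub>R b) = pd b f x * r" for r
      using has_derivative_linear[OF fx] by (simp add: linear_cmul)
    ultimately have "((\<lambda>s. f (s *\<^sub>R b + x)) has_real_derivative pd b f x) (at 0)"
      by (simp add: has_field_derivative_def)
    then have "((\<lambda>s. (f (s *\<^sub>R b + x) - f x) / s) \<longlongrightarrow> pd b f x) (at 0)"
      by (simp add: has_field_derivative_iff)
    then show ?thesis
      using t by (rule filterlim_compose)
  qed
  show ?thesis
    by (rule borel_measurable_LIMSEQ_real[OF l m])
qed

section \<open>One-sided differentiation of parameter integrals\<close>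

text \<open>Integrability is bundled with the limit because a Bochner integral that does not exist
  is 0, so the limit alone would not show that the integrals exist near \<theta> = 0, as
  \<open>lagrangian_has_dir_deriv\<close> demands.\<close>

definition has_right_deriv_integral :: "'a measure \<Rightarrow> (real \<Rightarrow> 'a \<Rightarrow> real) \<Rightarrow> ('a \<Rightarrow> real) \<Rightarrow> bool" where
  "has_right_deriv_integral M F d \<longleftrightarrow>
     integrable M (F 0) \<and> (\<forall>\<^sub>F \<theta> in at_right 0. integrable M (F \<theta>)) \<and> integrable M d \<and>
     ((\<lambda>\<theta>. ((\<integral>z. F \<theta> z \<partial>M) - (\<integral>z. F 0 z \<partial>M)) / \<theta>) \<longlongrightarrow> (\<integral>z. d z \<partial>M)) (at_right 0)"

lemma has_right_deriv_integralD:
  assumes "has_right_deriv_integral M F d"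
  shows "integrable M (F 0)" "\<forall>\<^sub>F \<theta> in at_right 0. integrable M (F \<theta>)" "integrable M d"
    "((\<lambda>\<theta>. ((\<integral>z. F \<theta> z \<partial>M) - (\<integral>z. F 0 z \<partial>M)) / \<theta>) \<longlongrightarrow> (\<integral>z. d z \<partial>M)) (at_right 0)"
  using assms by (simp_all add: has_right_deriv_integral_def)

lemma has_right_deriv_integral_add:
  assumes "has_right_deriv_integral M F d" "has_right_deriv_integral M G e"
  shows "has_right_deriv_integral M (\<lambda>\<theta> z. F \<theta> z + G \<theta> z) (\<lambda>z. d z + e z)"
proof -
  note F = has_right_deriv_integralD[OF assms(1)] and G = has_right_deriv_integralD[OF assms(2)]
  have "\<forall>\<^sub>F \<theta> in at_right 0. ((\<integral>z. F \<theta> z \<partial>M) - (\<integral>z. F 0 z \<partial>M)) / \<theta> + ((\<integral>z. G \<theta> z \<partial>M) - (\<integral>z. G 0 z \<partial>M)) / \<theta>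
      = ((\<integral>z. F \<theta> z + G \<theta> z \<partial>M) - (\<integral>z. F 0 z + G 0 z \<partial>M)) / \<theta>"
    using F(2) G(2) by eventually_elim (simp add: F(1) G(1) add_divide_distrib diff_divide_distrib)
  from Lim_transform_eventually[OF tendsto_add[OF F(4) G(4)] this] F G show ?thesis
    unfolding has_right_deriv_integral_def by (auto elim: eventually_elim2)
qed

lemma has_right_deriv_integral_cmult:
  assumes "has_right_deriv_integral M F d"
  shows "has_right_deriv_integral M (\<lambda>\<theta> z. c * F \<theta> z) (\<lambda>z. c * d z)"
proof -
  note F = has_right_deriv_integralD[OF assms]
  have "((\<lambda>\<theta>. c * (((\<integral>z. F \<theta> z \<partial>M) - (\<integral>z. F 0 z \<partial>M)) / \<theta>)) \<longlongrightarrow> c * (\<integral>z. d z \<partial>M)) (at_right 0)"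
    by (intro tendsto_mult_left F(4))
  then have "((\<lambda>\<theta>. ((\<integral>z. c * F \<theta> z \<partial>M) - (\<integral>z. c * F 0 z \<partial>M)) / \<theta>) \<longlongrightarrow> (\<integral>z. c * d z \<partial>M)) (at_right 0)"
    by (simp add: right_diff_distrib)
  with F show ?thesis
    unfolding has_right_deriv_integral_def by (auto elim: eventually_mono)
qed

lemma has_right_deriv_integral_sum:
  assumes "finite I" "\<And>i. i \<in> I \<Longrightarrow> has_right_deriv_integral M (F i) (d i)"
  shows "has_right_deriv_integral M (\<lambda>\<theta> z. \<Sum>i\<in>I. F i \<theta> z) (\<lambda>z. \<Sum>i\<in>I. d i z)"
  using assms
proof (induction I rule: finite_induct)
  case empty
  then show ?case by (simp add: has_right_deriv_integral_def)
next
  case (insert j I)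
  then show ?case
    using has_right_deriv_integral_add[of M "F j" "d j" "\<lambda>\<theta> z. \<Sum>i\<in>I. F i \<theta> z" "\<lambda>z. \<Sum>i\<in>I. d i z"] by simp
qed

text \<open>The integral is itself a quadratic polynomial in \<theta>, so no convergence theorem is
  involved. All terms of the Lagrangian except the quotients reduce to this case.\<close>

lemma has_right_deriv_integral_quadratic:
  assumes "integrable M A" "integrable M B" "integrable M C"
  shows "has_right_deriv_integral M (\<lambda>\<theta> z. A z + \<theta> * B z + \<theta>\<^sup>2 * C z) B"
proof -
  have "((\<lambda>\<theta>. (\<integral>z. B z \<partial>M) + \<theta> * (\<integral>z. C z \<partial>M)) \<longlongrightarrow> (\<integral>z. B z \<partial>M) + 0 * (\<integral>z. C z \<partial>M)) (at_right 0)"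
    by (intro tendsto_intros)
  moreover have "\<forall>\<^sub>F \<theta> in at_right (0::real). (\<integral>z. B z \<partial>M) + \<theta> * (\<integral>z. C z \<partial>M)
      = ((\<integral>z. A z + \<theta> * B z + \<theta>\<^sup>2 * C z \<partial>M) - (\<integral>z. A z + 0 * B z + 0\<^sup>2 * C z \<partial>M)) / \<theta>"
    unfolding eventually_at_filter
    by (rule always_eventually) (use assms in \<open>auto simp: field_simps power2_eq_square\<close>)
  ultimately have "((\<lambda>\<theta>. ((\<integral>z. A z + \<theta> * B z + \<theta>\<^sup>2 * C z \<partial>M) - (\<integral>z. A z + 0 * B z + 0\<^sup>2 * C z \<partial>M)) / \<theta>)
      \<longlongrightarrow> (\<integral>z. B z \<partial>M) + 0 * (\<integral>z. C z \<partial>M)) (at_right 0)"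
    by (rule Lim_transform_eventually)
  then show ?thesis
    unfolding has_right_deriv_integral_def using assms by auto
qed

lemma has_right_deriv_integral_linear:
  fixes u u' w :: "'a \<Rightarrow> real"
  assumes "integrable M (\<lambda>z. u z * w z)" "integrable M (\<lambda>z. u' z * w z)"
  shows "has_right_deriv_integral M (\<lambda>\<theta> z. (u z + \<theta> * u' z) * w z) (\<lambda>z. u' z * w z)"
proof -
  have eq: "(\<lambda>\<theta> z. (u z + \<theta> * u' z) * w z) = (\<lambda>\<theta> z. u z * w z + \<theta> * (u' z * w z) + \<theta>\<^sup>2 * 0)"
    by (simp add: fun_eq_iff algebra_simps)
  show ?thesis
    unfolding eq using assms by (intro has_right_deriv_integral_quadratic) auto
qed

lemma has_right_deriv_integral_square:
  fixes u u' w :: "'a \<Rightarrow> real"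
  assumes "integrable M (\<lambda>z. (u z)\<^sup>2 * w z)" "integrable M (\<lambda>z. u z * u' z * w z)" "integrable M (\<lambda>z. (u' z)\<^sup>2 * w z)"
  shows "has_right_deriv_integral M (\<lambda>\<theta> z. (u z + \<theta> * u' z)\<^sup>2 * w z) (\<lambda>z. 2 * (u z * u' z * w z))"
proof -
  have eq: "(\<lambda>\<theta> z. (u z + \<theta> * u' z)\<^sup>2 * w z) =
      (\<lambda>\<theta> z. (u z)\<^sup>2 * w z + \<theta> * (2 * (u z * u' z * w z)) + \<theta>\<^sup>2 * ((u' z)\<^sup>2 * w z))"
    by (simp add: fun_eq_iff power2_eq_square algebra_simps)
  show ?thesis
    unfolding eq using assms by (intro has_right_deriv_integral_quadratic) auto
qed

text \<open>The exceptional null set may depend on \<theta>, since only integrals at fixed \<theta>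
  are compared. This suits \<open>wpd\<close> of the perturbed state, which is chosen separately for
  each \<theta>.\<close>

lemma has_right_deriv_integral_cong_AE:
  assumes G: "has_right_deriv_integral M G d"
    and eq: "\<And>\<theta>. AE z in M. F \<theta> z = G \<theta> z" and F: "\<And>\<theta>. F \<theta> \<in> borel_measurable M"
  shows "has_right_deriv_integral M F d"
proof -
  note G = has_right_deriv_integralD[OF G]
  have cong: "integrable M (F \<theta>)" "(\<integral>z. F \<theta> z \<partial>M) = (\<integral>z. G \<theta> z \<partial>M)" if "integrable M (G \<theta>)" for \<theta>
    using that eq[of \<theta>] F[of \<theta>] integrable_cong_AE[of "F \<theta>" M "G \<theta>"] integral_cong_AE[of "F \<theta>" M "G \<theta>"]
    by auto
  have "\<forall>\<^sub>F \<theta> in at_right 0. ((\<integral>z. G \<theta> z \<partial>M) - (\<integral>z. G 0 z \<partial>M)) / \<theta> = ((\<integral>z. F \<theta> z \<partial>M) - (\<integral>z. F 0 z \<partial>M)) / \<theta>"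
    using G(2) by eventually_elim (simp add: cong G(1))
  from Lim_transform_eventually[OF G(4) this] show ?thesis
    unfolding has_right_deriv_integral_def
    using G cong(1) by (auto elim: eventually_mono)
qed

section \<open>Quotients whose denominator is bounded below\<close>

lemma integrable_divide_bounded_below:
  fixes a f :: "'a \<Rightarrow> real"
  assumes "integrable M f" "a \<in> borel_measurable M" "0 < c" "AE z in M. c \<le> a z"
  shows "integrable M (\<lambda>z. f z / a z)"
proof (rule Bochner_Integration.integrable_bound)
  show "integrable M (\<lambda>z. f z / c)" using assms by simp
  show "(\<lambda>z. f z / a z) \<in> borel_measurable M" using assms by measurable
  show "AE z in M. norm (f z / a z) \<le> norm (f z / c)"
    using assms(4) by eventually_elim (use assms(3) in \<open>auto intro!: divide_left_mono mult_pos_pos\<close>)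
qed

text \<open>The increment is divided by \<open>\<theta>\<close> before taking limits, so the factor of \<open>\<theta>\<close> is the difference quotient.\<close>

lemma quotient_difference:
  fixes a b c a' b' c' w \<theta> :: real
  assumes "a \<noteq> 0" "a + \<theta> * a' \<noteq> 0"
  shows "(b + \<theta> * b') * (c + \<theta> * c') / (a + \<theta> * a') * w = b * c / a * w +
    \<theta> * ((b' * c + b * c' + \<theta> * b' * c') / (a + \<theta> * a') * w - b * c / a * w * (a' / (a + \<theta> * a')))"
  using assms by (simp add: divide_simps) (simp add: algebra_simps)

text \<open>The condition \<open>\<theta> * K \<le> k / 2\<close> keeps the perturbed denominator
  above \<open>k / 2\<close>, hence its reciprocal below \<open>2 / k\<close>, and
  \<open>\<theta> \<le> 1\<close> absorbs the second-order term. The bound is free of \<theta> and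
  linear in four products that are integrable in the application.\<close>

lemma quotient_difference_bound:
  fixes a b c a' b' c' w \<theta> k K :: real
  assumes k: "0 < k" "k \<le> a" and K: "\<bar>a'\<bar> \<le> K" "\<bar>b'\<bar> \<le> K" "\<bar>c'\<bar> \<le> K"
    and \<theta>: "0 \<le> \<theta>" "\<theta> \<le> 1" "\<theta> * K \<le> k / 2"
  shows "a + \<theta> * a' > 0"
    and "\<bar>(b' * c + b * c' + \<theta> * b' * c') / (a + \<theta> * a') * w - b * c / a * w * (a' / (a + \<theta> * a'))\<bar>
      \<le> 2 * K / k * (\<bar>c * w\<bar> + \<bar>b * w\<bar> + \<bar>b' * w\<bar> + \<bar>b * c / a * w\<bar>)"
proof -
  have K0: "0 \<le> K" using K(1) by linarith
  have "\<bar>\<theta> * a'\<bar> \<le> \<theta> * K"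
    using \<theta>(1) K(1) by (simp add: abs_mult mult_left_mono)
  then have A: "k / 2 \<le> a + \<theta> * a'"
    using \<theta>(3) k by linarith
  then show pos: "a + \<theta> * a' > 0" using k by linarith
  have inv: "1 / (a + \<theta> * a') \<le> 2 / k"
    using A k pos by (simp add: divide_simps)
  have 1: "\<bar>b' * c * w\<bar> \<le> K * \<bar>c * w\<bar>" "\<bar>b * c' * w\<bar> \<le> K * \<bar>b * w\<bar>"
    using mult_right_mono[OF K(2), of "\<bar>c * w\<bar>"] mult_right_mono[OF K(3), of "\<bar>b * w\<bar>"]
    by (simp_all add: abs_mult ac_simps)
  have 2: "\<bar>\<theta> * b' * c' * w\<bar> \<le> K * \<bar>b' * w\<bar>"
  proof -
    have "\<bar>\<theta>\<bar> * \<bar>c'\<bar> \<le> 1 * K"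
      using \<theta> K(3) by (intro mult_mono) auto
    from mult_right_mono[OF this, of "\<bar>b' * w\<bar>"] show ?thesis
      by (simp add: abs_mult ac_simps)
  qed
  have 3: "\<bar>b * c / a * w * a'\<bar> \<le> K * \<bar>b * c / a * w\<bar>"
    using mult_right_mono[OF K(1), of "\<bar>b * c / a * w\<bar>"] by (simp add: abs_mult ac_simps)
  have tri: "\<bar>p + q + r - s\<bar> \<le> P + Q + R + S" if "\<bar>p\<bar> \<le> P" "\<bar>q\<bar> \<le> Q" "\<bar>r\<bar> \<le> R" "\<bar>s\<bar> \<le> S"
    for p q r s P Q R S :: real
    using that by linarith
  \<comment> \<open>\<open>X\<close> is the numerator over the common denominator
    \<open>a + \<theta> * a'\<close>. Each summand contains one factor bounded by \<open>K\<close>;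
    the factor \<open>2 / k\<close> comes from the denominator.\<close>
  define X where "X = b' * c * w + b * c' * w + \<theta> * b' * c' * w - b * c / a * w * a'"
  have X: "\<bar>X\<bar> \<le> K * (\<bar>c * w\<bar> + \<bar>b * w\<bar> + \<bar>b' * w\<bar> + \<bar>b * c / a * w\<bar>)"
    using tri[OF 1 2 3] unfolding X_def distrib_left .
  have "(b' * c + b * c' + \<theta> * b' * c') / (a + \<theta> * a') * w - b * c / a * w * (a' / (a + \<theta> * a'))
      = X * (1 / (a + \<theta> * a'))"
    unfolding X_def using pos k by (simp add: divide_simps) (simp add: algebra_simps)
  also have "\<bar>\<dots>\<bar> = \<bar>X\<bar> * (1 / (a + \<theta> * a'))"
    using pos by (simp add: abs_mult)
  also have "\<dots> \<le> K * (\<bar>c * w\<bar> + \<bar>b * w\<bar> + \<bar>b' * w\<bar> + \<bar>b * c / a * w\<bar>) * (2 / k)"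
    using X inv k pos K0 by (intro mult_mono) auto
  finally show "\<bar>(b' * c + b * c' + \<theta> * b' * c') / (a + \<theta> * a') * w - b * c / a * w * (a' / (a + \<theta> * a'))\<bar>
      \<le> 2 * K / k * (\<bar>c * w\<bar> + \<bar>b * w\<bar> + \<bar>b' * w\<bar> + \<bar>b * c / a * w\<bar>)"
    by (simp add: ac_simps)
qed

text \<open>\<open>Q \<theta>\<close> is the exact difference quotient of the integrand, not a
  first-order approximation. For small \<theta> it is dominated by the fixed function
  \<open>H\<close>, and its pointwise limit \<open>Q 0\<close> is the claimed derivative.\<close>

lemma has_right_deriv_integral_quotient:
  fixes a b c a' b' c' w :: "'a \<Rightarrow> real"
  assumes meas [measurable]: "a \<in> borel_measurable M" "b \<in> borel_measurable M" "c \<in> borel_measurable M"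
      "a' \<in> borel_measurable M" "b' \<in> borel_measurable M" "c' \<in> borel_measurable M" "w \<in> borel_measurable M"
    and k: "0 < k" "AE z in M. k \<le> a z"
    and K: "AE z in M. \<bar>a' z\<bar> \<le> K \<and> \<bar>b' z\<bar> \<le> K \<and> \<bar>c' z\<bar> \<le> K"
    and int: "integrable M (\<lambda>z. b z * c z / a z * w z)" "integrable M (\<lambda>z. b z * w z)"
      "integrable M (\<lambda>z. c z * w z)" "integrable M (\<lambda>z. b' z * w z)"
  shows "has_right_deriv_integral M
    (\<lambda>\<theta> z. (b z + \<theta> * b' z) * (c z + \<theta> * c' z) / (a z + \<theta> * a' z) * w z)
    (\<lambda>z. (b' z * c z + b z * c' z) / a z * w z - b z * c z / a z * w z * (a' z / a z))"
proof -
  define Q where "Q \<theta> z = (b' z * c z + b z * c' z + \<theta> * b' z * c' z) / (a z + \<theta> * a' z) * w z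
      - b z * c z / a z * w z * (a' z / (a z + \<theta> * a' z))" for \<theta> z
  define H where "H z = 2 * K / k * (\<bar>c z * w z\<bar> + \<bar>b z * w z\<bar> + \<bar>b' z * w z\<bar> + \<bar>b z * c z / a z * w z\<bar>)" for z
  define F where "F \<theta> z = (b z + \<theta> * b' z) * (c z + \<theta> * c' z) / (a z + \<theta> * a' z) * w z" for \<theta> z
  have Qm [measurable]: "Q \<theta> \<in> borel_measurable M" for \<theta>
    unfolding Q_def by measurable
  have Fm [measurable]: "F \<theta> \<in> borel_measurable M" for \<theta>
    unfolding F_def by measurable
  have H: "integrable M H"
    unfolding H_def using int by (intro integrable_mult_right Bochner_Integration.integrable_add integrable_abs)
  \<comment> \<open>Below \<delta> both smallness conditions of the pointwise bound hold. Using
    \<open>\<bar>K\<bar> + 1\<close> keeps the denominator positive whatever the sign of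
    \<open>K\<close>.\<close>
  define \<delta> where "\<delta> = min 1 (k / (2 * (\<bar>K\<bar> + 1)))"
  have \<delta>: "0 < \<delta>" using k by (simp add: \<delta>_def)
  have small: "\<theta> \<le> 1" "\<theta> * K \<le> k / 2" if "0 \<le> \<theta>" "\<theta> < \<delta>" for \<theta>
  proof -
    show "\<theta> \<le> 1" using that by (simp add: \<delta>_def)
    have "\<theta> * K \<le> \<theta> * (\<bar>K\<bar> + 1)" using that by (intro mult_left_mono) auto
    also have "\<dots> \<le> k / (2 * (\<bar>K\<bar> + 1)) * (\<bar>K\<bar> + 1)"
      using that by (intro mult_right_mono) (auto simp: \<delta>_def)
    also have "\<dots> = k / 2" by (simp add: divide_simps)
    finally show "\<theta> * K \<le> k / 2" .
  qed
  have bound: "AE z in M. \<bar>Q \<theta> z\<bar> \<le> H z" if "0 \<le> \<theta>" "\<theta> < \<delta>" for \<theta>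
    using k(2) K
    by eventually_elim (unfold Q_def H_def, rule quotient_difference_bound(2), use k(1) small that in auto)
  have Qi: "integrable M (Q \<theta>)" if "0 \<le> \<theta>" "\<theta> < \<delta>" for \<theta>
    using bound[OF that] by (intro Bochner_Integration.integrable_bound[OF H Qm]) (auto elim!: eventually_mono)
  have FQ: "AE z in M. F \<theta> z = F 0 z + \<theta> * Q \<theta> z" if "0 \<le> \<theta>" "\<theta> < \<delta>" for \<theta>
    using k(2) K
  proof eventually_elim
    case (elim z)
    have "a z + \<theta> * a' z > 0"
      using elim small[OF that] k(1) that by (intro quotient_difference_bound(1)[of k _ _ K "b' z" "c' z"]) auto
    with elim k(1) show ?case
      unfolding F_def Q_def by (subst quotient_difference) auto
  qed
  have "F 0 = (\<lambda>z. b z * c z / a z * w z)" by (simp add: F_def fun_eq_iff)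
  then have F0: "integrable M (F 0)" using int(1) by (simp only:)
  have Fi: "integrable M (F \<theta>)" and Fint: "(\<integral>z. F \<theta> z \<partial>M) = (\<integral>z. F 0 z \<partial>M) + \<theta> * (\<integral>z. Q \<theta> z \<partial>M)"
    if "0 \<le> \<theta>" "\<theta> < \<delta>" for \<theta>
  proof -
    have "integrable M (\<lambda>z. F 0 z + \<theta> * Q \<theta> z)"
      using F0 Qi[OF that] by simp
    then show "integrable M (F \<theta>)"
      using integrable_cong_AE[OF _ _ FQ[OF that]] by simp
    show "(\<integral>z. F \<theta> z \<partial>M) = (\<integral>z. F 0 z \<partial>M) + \<theta> * (\<integral>z. Q \<theta> z \<partial>M)"
      using integral_cong_AE[OF _ _ FQ[OF that]] F0 Qi[OF that] by simp
  qed
  have ev: "\<forall>\<^sub>F \<theta> in at_right 0. 0 \<le> \<theta> \<and> \<theta> < \<delta>"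
    using eventually_at_right_real[OF \<delta>] by (auto elim!: eventually_mono)
  have "((\<lambda>\<theta>. \<integral>z. Q \<theta> z \<partial>M) \<longlongrightarrow> (\<integral>z. Q 0 z \<partial>M)) (at_right 0)"
    \<comment> \<open>The dominated convergence theorem used here has a real parameter tending to
      infinity, so \<theta> is replaced by the reciprocal of that parameter.\<close>
    unfolding filterlim_at_right_to_top
  proof (rule integral_dominated_convergence_at_top[OF _ _ H])
    have "\<forall>\<^sub>F x in at_top. 0 \<le> inverse x \<and> inverse x < \<delta>"
      using ev by (simp only: eventually_at_right_to_top)
    then show "\<forall>\<^sub>F x in at_top. AE z in M. norm (Q (inverse x) z) \<le> H z"
      by eventually_elim (use bound in auto)
    show "AE z in M. ((\<lambda>x. Q (inverse x) z) \<longlongrightarrow> Q 0 z) at_top"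
      using k(2)
    proof eventually_elim
      case (elim z)
      then have "a z + 0 * a' z \<noteq> 0" using k(1) by simp
      then have "((\<lambda>\<theta>. Q \<theta> z) \<longlongrightarrow> Q 0 z) (at_right 0)"
        unfolding Q_def by (intro tendsto_intros) auto
      then show ?case by (simp only: filterlim_at_right_to_top)
    qed
  qed auto
  moreover have "\<forall>\<^sub>F \<theta> in at_right 0. (\<integral>z. Q \<theta> z \<partial>M) = ((\<integral>z. F \<theta> z \<partial>M) - (\<integral>z. F 0 z \<partial>M)) / \<theta>"
    using ev eventually_at_right_less[of 0] by eventually_elim (subst Fint, auto)
  ultimately have "((\<lambda>\<theta>. ((\<integral>z. F \<theta> z \<partial>M) - (\<integral>z. F 0 z \<partial>M)) / \<theta>) \<longlongrightarrow> (\<integral>z. Q 0 z \<partial>M)) (at_right 0)"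
    by (rule Lim_transform_eventually)
  moreover have "\<forall>\<^sub>F \<theta> in at_right 0. integrable M (F \<theta>)"
    using ev by eventually_elim (use Fi in auto)
  ultimately have "has_right_deriv_integral M F (Q 0)"
    unfolding has_right_deriv_integral_def using F0 Qi[of 0] \<delta> by auto
  then show ?thesis
    unfolding F_def[abs_def] Q_def[abs_def] by simp
qed

section \<open>The derivative of the Lagrangian\<close>

lemma space_time_Basis: "ex \<in> Basis" "ey \<in> Basis" "et \<in> Basis"
  by (auto simp: ex_def ey_def et_def Basis_prod_def zero_prod_def)

lemma open_cyl: "open \<Omega> \<Longrightarrow> open (cyl \<Omega> T)"
  by (simp add: cyl_def open_Times)

lemma cmp_perturb: "cmp (\<lambda>z. U z + \<theta> *\<^sub>R V z) i = (\<lambda>z. cmp U i z + \<theta> * cmp V i z)"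
  by (simp add: cmp_def)

text \<open>The left-hand side of the \<open>i\<close>-th adjoint equation plus \<open>2 (U\<^sub>i - u\<^sub>i\<^sub>d)\<close>, so that the equation reads
  \<open>R\<^sub>i = 2 \<Delta>U\<^sub>i\<close>. The terms are grouped so that each summand is integrable when the Lagrangian
  is defined; \<open>\<partial>\<^sub>y p\<^sub>2\<close> and \<open>\<partial>\<^sub>x p\<^sub>3\<close> only occur through their sum there.\<close>

definition adjoint_residual ::
    "spacetime set \<Rightarrow> real \<Rightarrow> (plane \<Rightarrow> real) \<Rightarrow> field \<Rightarrow> field \<Rightarrow> field \<Rightarrow> 3 \<Rightarrow> spacetime \<Rightarrow> real" where
  "adjoint_residual S g \<psi> Ud U P i z =
    (let h = cmp U 1; q1 = cmp U 2; q2 = cmp U 3; p1 = cmp P 1; p2 = cmp P 2; p3 = cmp P 3;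
         w = wpd S ey p2 z + wpd S ex p3 z
     in 2 * (cmp U i z - cmp Ud i z) - wpd S et (cmp P i) z +
       (if i = 1 then
          (q1 z)\<^sup>2 / h z * wpd S ex p2 z / h z + q1 z * q2 z / h z * w / h z + (q2 z)\<^sup>2 / h z * wpd S ey p3 z / h z
          - g * (h z * wpd S ex p2 z) - g * (h z * wpd S ey p3 z)
          + g * (p2 z * pd (1, 0) \<psi> (fst z) + p3 z * pd (0, 1) \<psi> (fst z))
        else if i = 2 then
          - wpd S ex p1 z - 2 * (q1 z * wpd S ex p2 z / h z) - q2 z * w / h z
        else
          - wpd S ey p1 z - 2 * (q2 z * wpd S ey p3 z / h z) - q1 z * w / h z))"

lemma strong_adjoint_system_iff_residual:
  "strong_adjoint_system \<Omega> T g \<psi> Ud U P \<longleftrightarrow>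
    (\<forall>i. (\<exists>v. has_weak_laplacian (cyl \<Omega> T) (cmp U i) v) \<and>
      (AE z in lebesgue_on (cyl \<Omega> T). adjoint_residual (cyl \<Omega> T) g \<psi> Ud U P i z = 2 * wlap (cyl \<Omega> T) (cmp U i) z))"
proof -
  let ?S = "cyl \<Omega> T" and ?h = "cmp U 1" and ?q1 = "cmp U 2" and ?q2 = "cmp U 3"
  let ?p1 = "cmp P 1" and ?p2 = "cmp P 2" and ?p3 = "cmp P 3"
  let ?L1 = "\<lambda>z. - wpd ?S et ?p1 z
           + wpd ?S ex ?p2 z * ((?q1 z)\<^sup>2 / (?h z)\<^sup>2 - g * ?h z)
           + wpd ?S ey ?p2 z * (?q1 z * ?q2 z / (?h z)\<^sup>2)
           + g * pd (1, 0) \<psi> (fst z) * ?p2 z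
           + wpd ?S ex ?p3 z * (?q1 z * ?q2 z / (?h z)\<^sup>2)
           + g * pd (0, 1) \<psi> (fst z) * ?p3 z
           + wpd ?S ey ?p3 z * ((?q2 z)\<^sup>2 / (?h z)\<^sup>2 - g * ?h z)"
  let ?L2 = "\<lambda>z. - wpd ?S et ?p2 z - wpd ?S ex ?p1 z
           - 2 * wpd ?S ex ?p2 z * (?q1 z / ?h z)
           - wpd ?S ey ?p2 z * (?q2 z / ?h z)
           - wpd ?S ex ?p3 z * (?q2 z / ?h z)"
  let ?L3 = "\<lambda>z. - wpd ?S et ?p3 z - wpd ?S ey ?p1 z
           - wpd ?S ey ?p2 z * (?q1 z / ?h z)
           - 2 * wpd ?S ey ?p3 z * (?q2 z / ?h z)
           - wpd ?S ex ?p3 z * (?q1 z / ?h z)"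
  \<comment> \<open>With division read as multiplication by an inverse, these are ring identities
    and hold at every \<open>z\<close>, even where the depth is 0.\<close>
  have R: "adjoint_residual ?S g \<psi> Ud U P 1 z = ?L1 z + 2 * (?h z - cmp Ud 1 z)"
    "adjoint_residual ?S g \<psi> Ud U P 2 z = ?L2 z + 2 * (?q1 z - cmp Ud 2 z)"
    "adjoint_residual ?S g \<psi> Ud U P 3 z = ?L3 z + 2 * (?q2 z - cmp Ud 3 z)" for z
    by (simp_all add: adjoint_residual_def Let_def divide_inverse power2_eq_square algebra_simps)
  have move: "(l = 2 * w - 2 * d) \<longleftrightarrow> (l + 2 * d = 2 * w)" for l w d :: real
    by linarith
  show ?thesis
    unfolding strong_adjoint_system_def Let_def move forall_3 R by blast
qed

text \<open>An open set misses its frontier, so both traces are 0 at every lateral point and the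
  exceptional set is empty.\<close>

lemma test_functions_no_normal_flux:
  assumes "open \<Omega>" "\<eta> \<in> test_functions (cyl \<Omega> T)" "\<zeta> \<in> test_functions (cyl \<Omega> T)"
  shows "no_normal_flux \<Omega> T n \<eta> \<zeta>"
proof -
  have "(x, t) \<notin> cyl \<Omega> T" if "x \<in> frontier \<Omega>" for x t
    using that assms(1) by (auto simp: cyl_def frontier_def interior_open)
  then have "\<exists>\<alpha> \<beta>. has_trace (cyl \<Omega> T) \<eta> (x, t) \<alpha> \<and> has_trace (cyl \<Omega> T) \<zeta> (x, t) \<beta>
      \<and> \<alpha> * fst (n x) + \<beta> * snd (n x) = 0" if "x \<in> frontier \<Omega>" for x t
    using that has_trace_test_function[OF assms(2)] has_trace_test_function[OF assms(3)]
    by (intro exI[of _ 0]) auto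
  then have empty: "{(x, t). x \<in> frontier \<Omega> \<and> t \<in> {0..T} \<and> \<not> (\<exists>\<alpha> \<beta>. has_trace (cyl \<Omega> T) \<eta> (x, t) \<alpha>
      \<and> has_trace (cyl \<Omega> T) \<zeta> (x, t) \<beta> \<and> \<alpha> * fst (n x) + \<beta> * snd (n x) = 0)} = {}"
    by blast
  have "surface_null {}"
    unfolding surface_null_def by (intro allI impI exI[of _ "\<lambda>_. {}"]) simp
  then show ?thesis
    unfolding no_normal_flux_def ae_lateral_def empty .
qed

section \<open>The setting, and local integrability of the residual\<close>

locale adjoint_setting =
  fixes \<Omega> :: "plane set" and T g :: real and \<psi> :: "plane \<Rightarrow> real"
    and Ud U P :: field and k :: real
  assumes open_\<Omega>: "open \<Omega>" and diff_\<psi>: "\<And>x. \<psi> differentiable (at x)"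
    and L2_Ud: "\<And>i. L2 (cyl \<Omega> T) (cmp Ud i)"
    and H1_U: "\<And>i. H1 (cyl \<Omega> T) (cmp U i)"
    and H1_P: "\<And>i. H1 (cyl \<Omega> T) (cmp P i)"
    and k_pos: "0 < k"
    and depth: "AE z in lebesgue_on (cyl \<Omega> T). k \<le> cmp U 1 z"
begin

abbreviation "S \<equiv> cyl \<Omega> T"
abbreviation "M \<equiv> lebesgue_on S"
abbreviation "p\<^sub>2\<^sub>x \<equiv> wpd S ex (cmp P 2)"
abbreviation "p\<^sub>3\<^sub>y \<equiv> wpd S ey (cmp P 3)"
abbreviation "shear \<equiv> (\<lambda>z. wpd S ey (cmp P 2) z + wpd S ex (cmp P 3) z)"
abbreviation "bottom \<equiv> (\<lambda>z. cmp P 2 z * pd (1, 0) \<psi> (fst z) + cmp P 3 z * pd (0, 1) \<psi> (fst z))"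

lemma open_S: "open S"
  using open_\<Omega> by (rule open_cyl)

lemma sets_S: "S \<in> sets lebesgue"
  using open_S by auto

lemma L2_H1: "H1 S u \<Longrightarrow> L2 S u"
  by (simp add: H1_def)

lemmas L2_wpd = H1_wpd(1)[OF open_S _ space_time_Basis(1)]
  H1_wpd(1)[OF open_S _ space_time_Basis(2)] H1_wpd(1)[OF open_S _ space_time_Basis(3)]

lemma L2_measurable: "L2 S u \<Longrightarrow> u \<in> borel_measurable M"
  by (simp add: L2_def)

lemma L2_weights: "L2 S p\<^sub>2\<^sub>x" "L2 S p\<^sub>3\<^sub>y" "L2 S shear"
  by (intro L2_wpd L2_add H1_P)+

lemma integrable_divide_depth: "integrable M f \<Longrightarrow> integrable M (\<lambda>z. f z / cmp U 1 z)"
  using k_pos depth L2_measurable[OF L2_H1[OF H1_U]]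
  by (intro integrable_divide_bounded_below) auto

lemma bottom_measurable: "bottom \<in> borel_measurable M"
proof -
  have "(\<lambda>z. pd b \<psi> (fst z)) \<in> borel_measurable M" for b
    using measurable_compose[OF borel_measurable_continuous_onI[OF continuous_on_fst[OF continuous_on_id]]
        borel_measurable_pd[OF diff_\<psi>, of b]]
    by (auto intro!: measurable_restrict_space1 measurable_completion)
  then show ?thesis
    using L2_measurable[OF L2_H1[OF H1_P]] by (intro borel_measurable_add borel_measurable_times)
qed

text \<open>The gradient of \<psi> may be unbounded, and the Lagrangian only guarantees
  integrability of the depth times \<open>bottom\<close>. As the depth is at least \<open>k\<close>,
  a function bounded by \<open>B\<close> is bounded by \<open>B / k\<close> times the depth.\<close>

lemma integrable_bounded_mult_bottom:
  assumes "lagrangian_defined \<Omega> T \<psi> U0 U P"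
    and f: "f \<in> borel_measurable M" "AE z in M. \<bar>f z\<bar> \<le> B"
  shows "integrable M (\<lambda>z. f z * bottom z)"
proof (rule Bochner_Integration.integrable_bound)
  have "integrable M (\<lambda>z. cmp U 1 z * bottom z)"
    using assms(1) by (simp add: lagrangian_defined_def Let_def)
  then show "integrable M (\<lambda>z. B / k * (cmp U 1 z * bottom z))"
    by (rule integrable_mult_right)
  show "(\<lambda>z. f z * bottom z) \<in> borel_measurable M"
    using f(1) bottom_measurable by (rule borel_measurable_times)
  show "AE z in M. norm (f z * bottom z) \<le> norm (B / k * (cmp U 1 z * bottom z))"
    using depth f(2)
  proof eventually_elim
    case (elim z)
    have "B * 1 \<le> B * (cmp U 1 z / k)"
      using elim k_pos by (intro mult_left_mono) auto
    with elim have "\<bar>f z\<bar> \<le> B / k * cmp U 1 z" by simp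
    then have "\<bar>f z\<bar> \<le> \<bar>B / k * cmp U 1 z\<bar>" by linarith
    from mult_right_mono[OF this abs_ge_zero[of "bottom z"]] show ?case
      by (simp only: real_norm_def abs_mult mult.assoc)
  qed
qed

lemma loc_integrable_arith:
  "loc_integrable S u \<Longrightarrow> loc_integrable S v \<Longrightarrow> loc_integrable S (\<lambda>z. u z + v z)"
  "loc_integrable S u \<Longrightarrow> loc_integrable S v \<Longrightarrow> loc_integrable S (\<lambda>z. u z - v z)"
  "loc_integrable S u \<Longrightarrow> loc_integrable S (\<lambda>z. - u z)"
  "loc_integrable S u \<Longrightarrow> loc_integrable S (\<lambda>z. c * u z)"
  by (auto simp: loc_integrable_def)

text \<open>Three sources cover all summands: the flux and bottom terms come from definedness of the
  Lagrangian, products of a state component with an adjoint derivative are products of L2 functions,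
  and the rest is itself L2. Dividing an integrable function by the depth keeps it
  integrable.\<close>

lemma loc_integrable_residual:
  assumes "lagrangian_defined \<Omega> T \<psi> U0 U P"
  shows "loc_integrable S (adjoint_residual S g \<psi> Ud U P i)"
proof -
  note L2l = L2_loc_integrable[OF _ sets_S]
  note il = integrable_loc_integrable[OF _ sets_S]
  have def: "integrable M (\<lambda>z. (cmp U 2 z)\<^sup>2 / cmp U 1 z * p\<^sub>2\<^sub>x z)"
    "integrable M (\<lambda>z. cmp U 2 z * cmp U 3 z / cmp U 1 z * shear z)"
    "integrable M (\<lambda>z. (cmp U 3 z)\<^sup>2 / cmp U 1 z * p\<^sub>3\<^sub>y z)"
    using assms by (simp_all add: lagrangian_defined_def Let_def)
  have prod: "integrable M (\<lambda>z. cmp U j z * p\<^sub>2\<^sub>x z)" "integrable M (\<lambda>z. cmp U j z * p\<^sub>3\<^sub>y z)"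
    "integrable M (\<lambda>z. cmp U j z * shear z)" for j
    by (intro L2_mult L2_H1 H1_U L2_weights)+
  \<comment> \<open>The bounded factor is the constant 1.\<close>
  have "integrable M bottom"
    using integrable_bounded_mult_bottom[OF assms, of "\<lambda>_. 1" 1] by simp
  note def = def this
  have base: "loc_integrable S (\<lambda>z. 2 * (cmp U i z - cmp Ud i z) - wpd S et (cmp P i) z)"
    by (intro loc_integrable_arith L2l L2_Ud L2_wpd H1_P L2_H1 H1_U)
  consider "i = 1" | "i = 2" | "i = 3" using exhaust_3 by blast
  then show ?thesis
  proof cases
    case 1
    show ?thesis
      unfolding adjoint_residual_def Let_def if_P[OF 1]
      by (rule loc_integrable_arith(1)[OF base])
         (intro loc_integrable_arith il[OF integrable_divide_depth[OF def(1)]] il[OF def(4)] il[OF prod(1)] il[OF prod(2)]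
           il[OF integrable_divide_depth[OF def(2)]] il[OF integrable_divide_depth[OF def(3)]])
  next
    case 2
    then have ne: "i \<noteq> 1" by simp_all
    show ?thesis
      unfolding adjoint_residual_def Let_def if_not_P[OF ne] if_P[OF 2]
      by (rule loc_integrable_arith(1)[OF base])
         (intro loc_integrable_arith L2l[OF L2_wpd(1)[OF H1_P]]
           il[OF integrable_divide_depth[OF prod(1)]] il[OF integrable_divide_depth[OF prod(3)]])
  next
    case 3
    then have ne: "i \<noteq> 1" "i \<noteq> 2" by simp_all
    show ?thesis
      unfolding adjoint_residual_def Let_def if_not_P[OF ne(1)] if_not_P[OF ne(2)]
      by (rule loc_integrable_arith(1)[OF base])
         (intro loc_integrable_arith L2l[OF L2_wpd(2)[OF H1_P]]
           il[OF integrable_divide_depth[OF prod(2)]] il[OF integrable_divide_depth[OF prod(3)]])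
  qed
qed

text \<open>Each integral of the Lagrangian is differentiated separately, and the integrands are
  then collected by components of the direction. The coefficient of \<open>cmp V i\<close>, apart
  from the gradient terms, is the residual.\<close>

lemma lagrangian_dir_deriv:
  assumes def: "lagrangian_defined \<Omega> T \<psi> U0 U P"
    and V: "\<And>i. H1 S (cmp V i)" and bounded: "ess_bounded S V"
  shows "lagrangian_has_dir_deriv \<Omega> T g \<psi> U0 Ud U P V
    (\<integral>z. (\<Sum>i\<in>UNIV. 2 * (wpd S ex (cmp U i) z * wpd S ex (cmp V i) z + wpd S ey (cmp U i) z * wpd S ey (cmp V i) z)
       + cmp V i z * adjoint_residual S g \<psi> Ud U P i z) \<partial>M)"
proof -
  let ?D = "\<lambda>z. \<Sum>i\<in>UNIV. 2 * (wpd S ex (cmp U i) z * wpd S ex (cmp V i) z + wpd S ey (cmp U i) z * wpd S ey (cmp V i) z)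
       + cmp V i z * adjoint_residual S g \<psi> Ud U P i z"
  obtain K where "AE z in M. norm (V z) \<le> K"
    using bounded by (auto simp: ess_bounded_def)
  then have K: "AE z in M. \<bar>cmp V i z\<bar> \<le> K" for i
    by eventually_elim (use component_le_norm_cart order_trans in \<open>fastforce simp: cmp_def\<close>)
  have Um: "cmp U i \<in> borel_measurable M" and Vm: "cmp V i \<in> borel_measurable M" for i
    using L2_measurable L2_H1 H1_U V by blast+
  have def': "integrable M (\<lambda>z. cmp U 2 z * cmp U 2 z / cmp U 1 z * p\<^sub>2\<^sub>x z)"
    "integrable M (\<lambda>z. (cmp U 1 z)\<^sup>2 * p\<^sub>2\<^sub>x z)"
    "integrable M (\<lambda>z. cmp U 2 z * cmp U 3 z / cmp U 1 z * shear z)"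
    "integrable M (\<lambda>z. cmp U 3 z * cmp U 3 z / cmp U 1 z * p\<^sub>3\<^sub>y z)"
    "integrable M (\<lambda>z. (cmp U 1 z)\<^sup>2 * p\<^sub>3\<^sub>y z)"
    "integrable M (\<lambda>z. cmp U 1 z * bottom z)"
    "\<forall>i. integrable (lebesgue_on \<Omega>) (\<lambda>x. cmp U0 i x * trace_value S (cmp P i) (x, 0))"
    using def by (simp_all add: lagrangian_defined_def Let_def power2_eq_square)

  have quot: "has_right_deriv_integral M
      (\<lambda>\<theta> z. (cmp U i z + \<theta> * cmp V i z) * (cmp U j z + \<theta> * cmp V j z) / (cmp U 1 z + \<theta> * cmp V 1 z) * w z)
      (\<lambda>z. (cmp V i z * cmp U j z + cmp U i z * cmp V j z) / cmp U 1 z * w z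
        - cmp U i z * cmp U j z / cmp U 1 z * w z * (cmp V 1 z / cmp U 1 z))"
    if "L2 S w" "integrable M (\<lambda>z. cmp U i z * cmp U j z / cmp U 1 z * w z)" for i j w
  proof (rule has_right_deriv_integral_quotient[where k = k and K = K])
    show "AE z in M. \<bar>cmp V 1 z\<bar> \<le> K \<and> \<bar>cmp V i z\<bar> \<le> K \<and> \<bar>cmp V j z\<bar> \<le> K"
      using K by (intro AE_conjI)
    show "integrable M (\<lambda>z. cmp U i z * w z)" "integrable M (\<lambda>z. cmp U j z * w z)"
      "integrable M (\<lambda>z. cmp V i z * w z)"
      by (intro L2_mult L2_H1 H1_U V that)+
  qed (use that Um Vm k_pos depth L2_measurable in auto)

  have square: "has_right_deriv_integral M (\<lambda>\<theta> z. (cmp U 1 z + \<theta> * cmp V 1 z)\<^sup>2 * w z)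
      (\<lambda>z. 2 * (cmp U 1 z * cmp V 1 z * w z))"
    if w: "L2 S w" and "integrable M (\<lambda>z. (cmp U 1 z)\<^sup>2 * w z)" for w
  proof (rule has_right_deriv_integral_square)
    \<comment> \<open>Boundedness of the direction makes \<open>cmp U 1 * cmp V 1\<close> and
      \<open>(cmp V 1)\<^sup>2\<close> square integrable, so that each can be paired with the L2
      weight \<open>w\<close>.\<close>
    show "integrable M (\<lambda>z. cmp U 1 z * cmp V 1 z * w z)" "integrable M (\<lambda>z. (cmp V 1 z)\<^sup>2 * w z)"
      unfolding power2_eq_square by (intro L2_mult L2_bounded_mult[OF _ Vm K] w L2_H1 H1_U V)+
  qed (use that in auto)

  have linear: "has_right_deriv_integral M (\<lambda>\<theta> z. (cmp U i z + \<theta> * cmp V i z) * w z) (\<lambda>z. cmp V i z * w z)"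
    if "L2 S w" for i w
    by (intro has_right_deriv_integral_linear L2_mult L2_H1 H1_U V that)

  have bottom_int: "integrable M (\<lambda>z. cmp V 1 z * bottom z)"
    using def Vm K by (rule integrable_bounded_mult_bottom)
  have bottom: "has_right_deriv_integral M (\<lambda>\<theta> z. (cmp U 1 z + \<theta> * cmp V 1 z) * bottom z) (\<lambda>z. cmp V 1 z * bottom z)"
    using def'(6) bottom_int by (rule has_right_deriv_integral_linear)

  have wpd_V: "has_weak_partial S b (\<lambda>z. cmp U i z + \<theta> * cmp V i z) (\<lambda>z. wpd S b (cmp U i) z + \<theta> * wpd S b (cmp V i) z)"
    if "b \<in> Basis" for b i \<theta>
    using that H1_wpd(2)[OF open_S] H1_U V by (intro has_weak_partial_add_scaled open_S) auto
  \<comment> \<open>For each \<theta> the chosen derivative of the perturbed component agrees almost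
    everywhere with the affine combination of derivatives. The factor 1 is the trivial weight in
    \<open>has_right_deriv_integral_square\<close>.\<close>
  have grad: "has_right_deriv_integral M (\<lambda>\<theta> z. (wpd S b (\<lambda>z. cmp U i z + \<theta> * cmp V i z) z)\<^sup>2)
      (\<lambda>z. 2 * (wpd S b (cmp U i) z * wpd S b (cmp V i) z * 1))" if b: "b \<in> Basis" for b i
  proof (rule has_right_deriv_integral_cong_AE)
    show "has_right_deriv_integral M (\<lambda>\<theta> z. (wpd S b (cmp U i) z + \<theta> * wpd S b (cmp V i) z)\<^sup>2 * 1)
        (\<lambda>z. 2 * (wpd S b (cmp U i) z * wpd S b (cmp V i) z * 1))"
      by (intro has_right_deriv_integral_square)
         (auto simp: power2_eq_square intro!: L2_mult H1_wpd(1)[OF open_S _ b] H1_U V)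
    show "AE z in M. (wpd S b (\<lambda>z. cmp U i z + \<theta> * cmp V i z) z)\<^sup>2
        = (wpd S b (cmp U i) z + \<theta> * wpd S b (cmp V i) z)\<^sup>2 * 1" for \<theta>
      using wpd_AE_eq[OF open_S wpd_V[OF b, of i \<theta>]] by eventually_elim simp
    have "wpd S b (\<lambda>z. cmp U i z + \<theta> * cmp V i z) \<in> borel_measurable M" for \<theta>
      using has_weak_partial_wpd[OF wpd_V[OF b]] has_weak_partial_loc_integrable
        loc_integrable_measurable[OF open_S] by blast
    then show "(\<lambda>z. (wpd S b (\<lambda>z. cmp U i z + \<theta> * cmp V i z) z)\<^sup>2) \<in> borel_measurable M" for \<theta>
      by measurable
  qed
  have track: "has_right_deriv_integral M (\<lambda>\<theta> z. (cmp U i z + \<theta> * cmp V i z - cmp Ud i z)\<^sup>2)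
      (\<lambda>z. 2 * ((cmp U i z - cmp Ud i z) * cmp V i z * 1))" for i
  proof -
    have "has_right_deriv_integral M (\<lambda>\<theta> z. ((cmp U i z - cmp Ud i z) + \<theta> * cmp V i z)\<^sup>2 * 1)
        (\<lambda>z. 2 * ((cmp U i z - cmp Ud i z) * cmp V i z * 1))"
      by (intro has_right_deriv_integral_square)
         (auto simp: power2_eq_square intro!: L2_mult L2_diff[OF L2_H1[OF H1_U] L2_Ud] L2_H1[OF V])
    then show ?thesis by (simp add: algebra_simps)
  qed

  let ?F1 = "\<lambda>\<theta> z. \<Sum>i\<in>UNIV. (wpd S ex (\<lambda>z. cmp U i z + \<theta> * cmp V i z) z)\<^sup>2 + (wpd S ey (\<lambda>z. cmp U i z + \<theta> * cmp V i z) z)\<^sup>2"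
  let ?d1 = "\<lambda>z. \<Sum>i\<in>UNIV. 2 * (wpd S ex (cmp U i) z * wpd S ex (cmp V i) z * 1) + 2 * (wpd S ey (cmp U i) z * wpd S ey (cmp V i) z * 1)"
  have F1: "has_right_deriv_integral M ?F1 ?d1"
    by (intro has_right_deriv_integral_sum has_right_deriv_integral_add grad space_time_Basis) auto
  let ?F2 = "\<lambda>\<theta> z. \<Sum>i\<in>UNIV. (cmp U i z + \<theta> * cmp V i z - cmp Ud i z)\<^sup>2"
  let ?d2 = "\<lambda>z. \<Sum>i\<in>UNIV. 2 * ((cmp U i z - cmp Ud i z) * cmp V i z * 1)"
  have F2: "has_right_deriv_integral M ?F2 ?d2"
    by (intro has_right_deriv_integral_sum track) auto
  let ?F3 = "\<lambda>\<theta> z. (\<Sum>i\<in>UNIV. (cmp U i z + \<theta> * cmp V i z) * wpd S et (cmp P i) z)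
    + (cmp U 2 z + \<theta> * cmp V 2 z) * wpd S ex (cmp P 1) z + (cmp U 3 z + \<theta> * cmp V 3 z) * wpd S ey (cmp P 1) z"
  let ?d3 = "\<lambda>z. (\<Sum>i\<in>UNIV. cmp V i z * wpd S et (cmp P i) z) + cmp V 2 z * wpd S ex (cmp P 1) z + cmp V 3 z * wpd S ey (cmp P 1) z"
  have F3: "has_right_deriv_integral M ?F3 ?d3"
    by (intro has_right_deriv_integral_sum has_right_deriv_integral_add linear L2_wpd H1_P) auto
  note Q22 = quot[OF L2_weights(1) def'(1)] and Q23 = quot[OF L2_weights(3) def'(3)]
    and Q33 = quot[OF L2_weights(2) def'(4)]
    and s2 = square[OF L2_weights(1) def'(2)] and s3 = square[OF L2_weights(2) def'(5)]
  let ?F4 = "\<lambda>\<theta> z. ((cmp U 2 z + \<theta> * cmp V 2 z)\<^sup>2 / (cmp U 1 z + \<theta> * cmp V 1 z) + g / 2 * (cmp U 1 z + \<theta> * cmp V 1 z)\<^sup>2) * p\<^sub>2\<^sub>x z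
    + (cmp U 2 z + \<theta> * cmp V 2 z) * (cmp U 3 z + \<theta> * cmp V 3 z) / (cmp U 1 z + \<theta> * cmp V 1 z) * shear z
    + ((cmp U 3 z + \<theta> * cmp V 3 z)\<^sup>2 / (cmp U 1 z + \<theta> * cmp V 1 z) + g / 2 * (cmp U 1 z + \<theta> * cmp V 1 z)\<^sup>2) * p\<^sub>3\<^sub>y z"
  let ?d4 = "(\<lambda>z. ((cmp V 2 z * cmp U 2 z + cmp U 2 z * cmp V 2 z) / cmp U 1 z * p\<^sub>2\<^sub>x z
        - cmp U 2 z * cmp U 2 z / cmp U 1 z * p\<^sub>2\<^sub>x z * (cmp V 1 z / cmp U 1 z))
      + g / 2 * (2 * (cmp U 1 z * cmp V 1 z * p\<^sub>2\<^sub>x z))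
      + ((cmp V 2 z * cmp U 3 z + cmp U 2 z * cmp V 3 z) / cmp U 1 z * shear z
        - cmp U 2 z * cmp U 3 z / cmp U 1 z * shear z * (cmp V 1 z / cmp U 1 z))
      + ((cmp V 3 z * cmp U 3 z + cmp U 3 z * cmp V 3 z) / cmp U 1 z * p\<^sub>3\<^sub>y z
        - cmp U 3 z * cmp U 3 z / cmp U 1 z * p\<^sub>3\<^sub>y z * (cmp V 1 z / cmp U 1 z))
      + g / 2 * (2 * (cmp U 1 z * cmp V 1 z * p\<^sub>3\<^sub>y z)))"
  have F4: "has_right_deriv_integral M ?F4 ?d4"
  proof -
    \<comment> \<open>The flux is split into summands that match the separate integrability clauses
      of \<open>lagrangian_defined\<close>.\<close>
    have "?F4 = (\<lambda>\<theta> z. (cmp U 2 z + \<theta> * cmp V 2 z) * (cmp U 2 z + \<theta> * cmp V 2 z) / (cmp U 1 z + \<theta> * cmp V 1 z) * p\<^sub>2\<^sub>x z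
      + g / 2 * ((cmp U 1 z + \<theta> * cmp V 1 z)\<^sup>2 * p\<^sub>2\<^sub>x z)
      + (cmp U 2 z + \<theta> * cmp V 2 z) * (cmp U 3 z + \<theta> * cmp V 3 z) / (cmp U 1 z + \<theta> * cmp V 1 z) * shear z
      + (cmp U 3 z + \<theta> * cmp V 3 z) * (cmp U 3 z + \<theta> * cmp V 3 z) / (cmp U 1 z + \<theta> * cmp V 1 z) * p\<^sub>3\<^sub>y z
      + g / 2 * ((cmp U 1 z + \<theta> * cmp V 1 z)\<^sup>2 * p\<^sub>3\<^sub>y z))"
      by (intro ext) (simp only: power2_eq_square distrib_right mult.assoc add.assoc)
    then show ?thesis
      by (simp only:) (intro has_right_deriv_integral_add has_right_deriv_integral_cmult Q22 Q23 Q33 s2 s3)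
  qed
  let ?F5 = "\<lambda>\<theta> z. g * (cmp U 1 z + \<theta> * cmp V 1 z) * bottom z"
  let ?d5 = "\<lambda>z. g * (cmp V 1 z * bottom z)"
  have F5: "has_right_deriv_integral M ?F5 ?d5"
    using has_right_deriv_integral_cmult[OF bottom, of g] by (simp only: mult.assoc)

  define L where "L \<theta> = lagrangian \<Omega> T g \<psi> U0 Ud (\<lambda>z. U z + \<theta> *\<^sub>R V z) P" for \<theta>
  define C where "C = (\<integral>x. (\<Sum>i\<in>UNIV. cmp U0 i x * trace_value S (cmp P i) (x, 0)) \<partial>lebesgue_on \<Omega>)"
  have L: "L \<theta> = integral\<^sup>L M (?F1 \<theta>) + integral\<^sup>L M (?F2 \<theta>) - integral\<^sup>L M (?F3 \<theta>) - C
      - integral\<^sup>L M (?F4 \<theta>) + integral\<^sup>L M (?F5 \<theta>)" for \<theta>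
    unfolding L_def lagrangian_def objective_def Let_def cmp_perturb C_def by (rule refl)
  let ?q = "\<lambda>F \<theta>. (integral\<^sup>L M (F \<theta>) - integral\<^sup>L M (F 0)) / \<theta>"
  have lim: "((\<lambda>\<theta>. ?q ?F1 \<theta> + ?q ?F2 \<theta> - ?q ?F3 \<theta> - ?q ?F4 \<theta> + ?q ?F5 \<theta>) \<longlongrightarrow>
      integral\<^sup>L M ?d1 + integral\<^sup>L M ?d2 - integral\<^sup>L M ?d3 - integral\<^sup>L M ?d4 + integral\<^sup>L M ?d5) (at_right 0)"
    by (intro tendsto_add tendsto_diff has_right_deriv_integralD(4) F1 F2 F3 F4 F5)
  \<comment> \<open>The initial-data term \<open>C\<close> is independent of \<theta> and
    cancels.\<close>
  have "(L \<theta> - L 0) / \<theta> = ?q ?F1 \<theta> + ?q ?F2 \<theta> - ?q ?F3 \<theta> - ?q ?F4 \<theta> + ?q ?F5 \<theta>" for \<theta>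
    unfolding L by (simp only: diff_divide_distrib add_divide_distrib)
  with lim have lim': "((\<lambda>\<theta>. (L \<theta> - L 0) / \<theta>) \<longlongrightarrow>
      integral\<^sup>L M ?d1 + integral\<^sup>L M ?d2 - integral\<^sup>L M ?d3 - integral\<^sup>L M ?d4 + integral\<^sup>L M ?d5) (at_right 0)"
    by (simp only:)
  have sum5: "integral\<^sup>L M f1 + integral\<^sup>L M f2 - integral\<^sup>L M f3 - integral\<^sup>L M f4 + integral\<^sup>L M f5 =
      (\<integral>z. f1 z + f2 z - f3 z - f4 z + f5 z \<partial>M)"
    if "integrable M f1" "integrable M f2" "integrable M f3" "integrable M f4" "integrable M f5"
    for f1 f2 f3 f4 f5 :: "spacetime \<Rightarrow> real"
    using that by simp
  have "integral\<^sup>L M ?d1 + integral\<^sup>L M ?d2 - integral\<^sup>L M ?d3 - integral\<^sup>L M ?d4 + integral\<^sup>L M ?d5 =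
      (\<integral>z. ?d1 z + ?d2 z - ?d3 z - ?d4 z + ?d5 z \<partial>M)"
    by (rule sum5; rule has_right_deriv_integralD(3), (rule F1 F2 F3 F4 F5))
  also have "\<dots> = integral\<^sup>L M ?D"
  proof (rule integral_cong_AE)
    show "(\<lambda>z. ?d1 z + ?d2 z - ?d3 z - ?d4 z + ?d5 z) \<in> borel_measurable M"
      using F1 F2 F3 F4 F5
      by (intro borel_measurable_add borel_measurable_diff borel_measurable_integrable has_right_deriv_integralD(3))
    show "?D \<in> borel_measurable M"
      by (intro borel_measurable_sum borel_measurable_add borel_measurable_times borel_measurable_const Vm
          L2_measurable[OF L2_wpd(1)[OF H1_U]] L2_measurable[OF L2_wpd(2)[OF H1_U]]
          L2_measurable[OF L2_wpd(1)[OF V]] L2_measurable[OF L2_wpd(2)[OF V]]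
          loc_integrable_measurable[OF open_S loc_integrable_residual[OF def]])
    show "AE z in M. ?d1 z + ?d2 z - ?d3 z - ?d4 z + ?d5 z = ?D z"
      using depth
    proof eventually_elim
      case (elim z)
      then have "cmp U 1 z \<noteq> 0" using k_pos by simp
      then show ?case
        unfolding sum_3 adjoint_residual_def Let_def
        by (simp add: divide_simps power2_eq_square) (simp add: algebra_simps)
    qed
  qed
  finally have d: "integral\<^sup>L M ?d1 + integral\<^sup>L M ?d2 - integral\<^sup>L M ?d3 - integral\<^sup>L M ?d4 + integral\<^sup>L M ?d5 = \<dots>" .
  show ?thesis
    unfolding lagrangian_has_dir_deriv_def
  proof (intro conjI)
    \<comment> \<open>Terms linear in the state with an L2 weight are integrable for every \<theta>;
      quotients, squares and the bottom term are so for small \<theta>, as the differentiation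
      results provide. The initial-data clause does not involve the state.\<close>
    show "\<forall>\<^sub>F \<theta> in at_right 0. lagrangian_defined \<Omega> T \<psi> U0 (\<lambda>z. U z + \<theta> *\<^sub>R V z) P"
      using has_right_deriv_integralD(2)[OF Q22] has_right_deriv_integralD(2)[OF Q23]
        has_right_deriv_integralD(2)[OF Q33] has_right_deriv_integralD(2)[OF s2]
        has_right_deriv_integralD(2)[OF s3] has_right_deriv_integralD(2)[OF bottom]
    proof eventually_elim
      case (elim \<theta>)
      have lin: "integrable M (\<lambda>z. (cmp U i z + \<theta> * cmp V i z) * w z)" if "L2 S w" for i w
        by (intro L2_mult L2_add L2_cmult L2_H1 H1_U V that)
      show ?case
        unfolding lagrangian_defined_def Let_def cmp_perturb
        using elim def'(7) by (auto simp: power2_eq_square intro!: lin L2_wpd H1_P)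
    qed
    show "((\<lambda>\<theta>. (lagrangian \<Omega> T g \<psi> U0 Ud (\<lambda>z. U z + \<theta> *\<^sub>R V z) P - lagrangian \<Omega> T g \<psi> U0 Ud U P) / \<theta>) \<longlongrightarrow>
        integral\<^sup>L M ?D) (at_right 0)"
      using lim' unfolding d by (simp add: L_def)
  qed (rule def)
qed

section \<open>Equivalence of the adjoint equation and the strong system\<close>

lemma adjoint_equation_imp_weak:
  assumes adj: "adjoint_equation \<Omega> T n g \<psi> U0 Ud U P" and \<eta>: "\<eta> \<in> test_functions S"
  shows "(\<integral>z. 2 * (wpd S ex (cmp U i) z * pd ex \<eta> z + wpd S ey (cmp U i) z * pd ey \<eta> z)
      + \<eta> z * adjoint_residual S g \<psi> Ud U P i z \<partial>M) = 0"
proof -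
  \<comment> \<open>Perturbing the \<open>i\<close>-th component alone isolates the
    \<open>i\<close>-th equation of the system.\<close>
  define V :: field where "V z = axis i (\<eta> z)" for z
  define \<zeta> where "\<zeta> j = (if j = i then \<eta> else (\<lambda>_. 0))" for j
  have cmp_V: "cmp V j = \<zeta> j" for j
    by (auto simp: cmp_def V_def \<zeta>_def axis_def fun_eq_iff)
  have \<zeta>: "\<zeta> j \<in> test_functions S" for j
    using \<eta> by (simp add: \<zeta>_def zero_test_function)
  have VH: "H1 S (cmp V j)" for j
    unfolding cmp_V using \<zeta> open_S by (rule H1_test_function)
  have V: "V \<in> V_space \<Omega> T n"
    using VH test_functions_no_normal_flux[OF open_\<Omega> \<zeta> \<zeta>] by (simp add: V_space_def cmp_V)
  have bounded: "ess_bounded S V"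
  proof -
    obtain B where "\<And>z. \<bar>\<eta> z\<bar> \<le> B"
      using test_function_bounded[OF \<eta>] by metis
    then have "AE z in M. norm (V z) \<le> B"
      by (simp add: V_def norm_eq_sqrt_inner inner_axis_axis)
    then show ?thesis by (auto simp: ess_bounded_def)
  qed
  let ?D = "\<lambda>z. \<Sum>j\<in>UNIV. 2 * (wpd S ex (cmp U j) z * wpd S ex (cmp V j) z + wpd S ey (cmp U j) z * wpd S ey (cmp V j) z)
       + cmp V j z * adjoint_residual S g \<psi> Ud U P j z"
  have d0: "lagrangian_has_dir_deriv \<Omega> T g \<psi> U0 Ud U P V 0"
    using adj V bounded by (simp add: adjoint_equation_def)
  then have def: "lagrangian_defined \<Omega> T \<psi> U0 U P"
    by (simp add: lagrangian_has_dir_deriv_def)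
  \<comment> \<open>The same difference quotients tend to 0 by the adjoint equation and to the
    integral by the derivative formula; limits are unique.\<close>
  have "integral\<^sup>L M ?D = 0"
    using d0 lagrangian_dir_deriv[OF def VH bounded] tendsto_unique[OF trivial_limit_at_right_real]
    unfolding lagrangian_has_dir_deriv_def by blast
  moreover have "integral\<^sup>L M ?D = (\<integral>z. 2 * (wpd S ex (cmp U i) z * pd ex \<eta> z + wpd S ey (cmp U i) z * pd ey \<eta> z)
      + \<eta> z * adjoint_residual S g \<psi> Ud U P i z \<partial>M)"
  proof (rule integral_cong_AE)
    note meas = L2_measurable[OF L2_wpd(1)[OF H1_U]] L2_measurable[OF L2_wpd(2)[OF H1_U]]
      loc_integrable_measurable[OF open_S loc_integrable_residual[OF def]]
    show "?D \<in> borel_measurable M"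
      by (intro borel_measurable_sum borel_measurable_add borel_measurable_times borel_measurable_const meas
          L2_measurable[OF L2_H1[OF VH]] L2_measurable[OF L2_wpd(1)[OF VH]] L2_measurable[OF L2_wpd(2)[OF VH]])
    show "(\<lambda>z. 2 * (wpd S ex (cmp U i) z * pd ex \<eta> z + wpd S ey (cmp U i) z * pd ey \<eta> z)
      + \<eta> z * adjoint_residual S g \<psi> Ud U P i z) \<in> borel_measurable M"
      by (intro borel_measurable_add borel_measurable_times borel_measurable_const meas test_function_measurable[OF \<eta>]
          test_function_measurable[OF test_function_pd[OF \<eta> space_time_Basis(1)]]
          test_function_measurable[OF test_function_pd[OF \<eta> space_time_Basis(2)]])
    have "AE z in M. wpd S b (cmp V j) z = (if j = i then pd b \<eta> z else 0)" if "b \<in> Basis" for b j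
      using wpd_AE_eq[OF open_S test_function_weak_partial[OF \<zeta>[of j] that open_S]]
      unfolding cmp_V by eventually_elim (simp add: \<zeta>_def frechet_derivative_const)
    then have "AE z in M. \<forall>j\<in>UNIV. wpd S ex (cmp V j) z = (if j = i then pd ex \<eta> z else 0)"
      "AE z in M. \<forall>j\<in>UNIV. wpd S ey (cmp V j) z = (if j = i then pd ey \<eta> z else 0)"
      using space_time_Basis by (intro AE_finite_allI; simp)+
    then show "AE z in M. ?D z = 2 * (wpd S ex (cmp U i) z * pd ex \<eta> z + wpd S ey (cmp U i) z * pd ey \<eta> z)
      + \<eta> z * adjoint_residual S g \<psi> Ud U P i z"
    proof eventually_elim
      case (elim z)
      have "?D z = (\<Sum>j\<in>UNIV. if j = i then 2 * (wpd S ex (cmp U j) z * pd ex \<eta> z + wpd S ey (cmp U j) z * pd ey \<eta> z)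
          + \<eta> z * adjoint_residual S g \<psi> Ud U P j z else 0)"
        using elim by (intro sum.cong) (auto simp: cmp_V \<zeta>_def)
      then show ?case by simp
    qed
  qed
  ultimately show ?thesis by simp
qed

text \<open>The partial derivatives of \<eta> are test functions too, so the definition of the weak
  derivative moves the gradient from \<open>U\<close> onto \<eta> and produces the Laplacian of
  \<eta>. The factor 2 of the squared gradient explains the division of the residual by 2.\<close>

lemma adjoint_equation_imp_weak_laplacian:
  assumes adj: "adjoint_equation \<Omega> T n g \<psi> U0 Ud U P"
  shows "has_weak_laplacian S (cmp U i) (\<lambda>z. adjoint_residual S g \<psi> Ud U P i z / 2)"
  unfolding has_weak_laplacian_def
proof (intro conjI ballI)
  \<comment> \<open>The zero direction serves only to extract that the Lagrangian is defined at
    \<open>U\<close>, which makes the residual locally integrable before any test function is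
    fixed.\<close>
  have zero: "(\<lambda>_. 0) \<in> V_space \<Omega> T n" "ess_bounded S (\<lambda>_. 0)"
    using H1_test_function[OF zero_test_function open_S]
      test_functions_no_normal_flux[OF open_\<Omega> zero_test_function zero_test_function]
    by (auto simp: V_space_def cmp_def ess_bounded_def)
  then have "lagrangian_has_dir_deriv \<Omega> T g \<psi> U0 Ud U P (\<lambda>_. 0) 0"
    using adj unfolding adjoint_equation_def by blast
  then have def: "lagrangian_defined \<Omega> T \<psi> U0 U P"
    unfolding lagrangian_has_dir_deriv_def by blast
  have R: "loc_integrable S (adjoint_residual S g \<psi> Ud U P i)"
    using def by (rule loc_integrable_residual)
  then show "loc_integrable S (\<lambda>z. adjoint_residual S g \<psi> Ud U P i z / 2)"
    by (simp add: loc_integrable_def)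
  show "loc_integrable S (cmp U i)"
    by (intro L2_loc_integrable L2_H1 H1_U sets_S)
  fix \<eta> assume \<eta>: "\<eta> \<in> test_functions S"
  let ?R = "adjoint_residual S g \<psi> Ud U P i"
  have pd: "pd b \<eta> \<in> test_functions S" "pd b (pd b \<eta>) \<in> test_functions S" if "b \<in> Basis" for b
    using \<eta> that by (auto intro: test_function_pd)
  have grad: "integrable M (\<lambda>z. wpd S b (cmp U i) z * pd b \<eta> z)"
    "integrable M (\<lambda>z. cmp U i z * pd b (pd b \<eta>) z)"
    "(\<integral>z. cmp U i z * pd b (pd b \<eta>) z \<partial>M) = - (\<integral>z. wpd S b (cmp U i) z * pd b \<eta> z \<partial>M)" if "b \<in> Basis" for b
    using H1_wpd[OF open_S H1_U that, of i] pd[OF that] L2_H1[OF H1_U, of i] L2_test_function[OF _ open_S]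
    by (auto simp: has_weak_partial_def intro!: L2_mult)
  have "integrable M (\<lambda>z. ?R z * \<eta> z)"
    using R sets_S \<eta> by (rule loc_integrable_mult_test_function)
  then have Ri: "integrable M (\<lambda>z. \<eta> z * ?R z)"
    by (simp add: mult.commute)
  note x = grad[OF space_time_Basis(1)] and y = grad[OF space_time_Basis(2)]
  have 1: "2 * ((\<integral>z. wpd S ex (cmp U i) z * pd ex \<eta> z \<partial>M) + (\<integral>z. wpd S ey (cmp U i) z * pd ey \<eta> z \<partial>M))
      + (\<integral>z. \<eta> z * ?R z \<partial>M) = 0"
    using adjoint_equation_imp_weak[OF adj \<eta>, of i] x(1) y(1) Ri by simp
  have 2: "(\<integral>z. cmp U i z * (pd ex (pd ex \<eta>) z + pd ey (pd ey \<eta>) z) \<partial>M)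
      = (\<integral>z. cmp U i z * pd ex (pd ex \<eta>) z \<partial>M) + (\<integral>z. cmp U i z * pd ey (pd ey \<eta>) z \<partial>M)"
    using x(2) y(2) by (simp add: distrib_left)
  have 3: "(\<integral>z. ?R z / 2 * \<eta> z \<partial>M) = (\<integral>z. \<eta> z * ?R z \<partial>M) / 2"
    by (simp add: mult.commute)
  have alg: "u = v" if "2 * (a + b) + r = 0" "u = c + d" "v = r / 2" "c = - a" "d = - b" for a b c d r u v :: real
    using that by (simp add: field_simps)
  show "(\<integral>z. cmp U i z * (pd ex (pd ex \<eta>) z + pd ey (pd ey \<eta>) z) \<partial>M) = (\<integral>z. ?R z / 2 * \<eta> z \<partial>M)"
    using 1 2 3 x(3) y(3) by (rule alg)
qed

lemma adjoint_equation_imp_strong: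
  assumes "adjoint_equation \<Omega> T n g \<psi> U0 Ud U P"
  shows "strong_adjoint_system \<Omega> T g \<psi> Ud U P"
  unfolding strong_adjoint_system_iff_residual
proof (intro allI conjI)
  fix i :: 3
  note lap = adjoint_equation_imp_weak_laplacian[OF assms, of i]
  show "\<exists>v. has_weak_laplacian S (cmp U i) v" using lap by blast
  show "AE z in M. adjoint_residual S g \<psi> Ud U P i z = 2 * wlap S (cmp U i) z"
    using wlap_AE_eq[OF open_S lap] by eventually_elim simp
qed

text \<open>Replacing the residual by twice the weak Laplacian turns the derivative formula into
  twice the integral in \<open>no_boundary_term\<close>. Definedness is a separate hypothesis
  because the strong system speaks of equations almost everywhere, not of the integrals in the
  Lagrangian.\<close>

lemma strong_imp_adjoint_equation:
  assumes def: "lagrangian_defined \<Omega> T \<psi> U0 U P"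
    and strong: "strong_adjoint_system \<Omega> T g \<psi> Ud U P"
    and bdry: "no_boundary_term \<Omega> T n U"
  shows "adjoint_equation \<Omega> T n g \<psi> U0 Ud U P"
  unfolding adjoint_equation_def
proof (intro ballI impI)
  fix V assume V: "V \<in> V_space \<Omega> T n" and bounded: "ess_bounded S V"
  have VH: "H1 S (cmp V i)" for i using V by (simp add: V_space_def)
  have lap: "has_weak_laplacian S (cmp U i) (wlap S (cmp U i))"
    and R: "AE z in M. adjoint_residual S g \<psi> Ud U P i z = 2 * wlap S (cmp U i) z" for i
    using strong has_weak_laplacian_wlap unfolding strong_adjoint_system_iff_residual by blast+
  let ?B = "\<lambda>z. \<Sum>i\<in>UNIV. wpd S ex (cmp U i) z * wpd S ex (cmp V i) z + wpd S ey (cmp U i) z * wpd S ey (cmp V i) z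
      + wlap S (cmp U i) z * cmp V i z"
  have "(\<integral>z. (\<Sum>i\<in>UNIV. 2 * (wpd S ex (cmp U i) z * wpd S ex (cmp V i) z + wpd S ey (cmp U i) z * wpd S ey (cmp V i) z)
       + cmp V i z * adjoint_residual S g \<psi> Ud U P i z) \<partial>M) = (\<integral>z. 2 * ?B z \<partial>M)"
  proof (rule integral_cong_AE)
    have wm: "wlap S (cmp U i) \<in> borel_measurable M" for i
      using lap by (intro loc_integrable_measurable open_S) (simp add: has_weak_laplacian_def)
    note meas = L2_measurable[OF L2_wpd(1)[OF H1_U]] L2_measurable[OF L2_wpd(2)[OF H1_U]]
      L2_measurable[OF L2_wpd(1)[OF VH]] L2_measurable[OF L2_wpd(2)[OF VH]] L2_measurable[OF L2_H1[OF VH]]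
      loc_integrable_measurable[OF open_S loc_integrable_residual[OF def]]
    show "(\<lambda>z. \<Sum>i\<in>UNIV. 2 * (wpd S ex (cmp U i) z * wpd S ex (cmp V i) z + wpd S ey (cmp U i) z * wpd S ey (cmp V i) z)
       + cmp V i z * adjoint_residual S g \<psi> Ud U P i z) \<in> borel_measurable M"
      by (intro borel_measurable_sum borel_measurable_add borel_measurable_times borel_measurable_const meas)
    show "(\<lambda>z. 2 * ?B z) \<in> borel_measurable M"
      by (intro borel_measurable_sum borel_measurable_add borel_measurable_times borel_measurable_const meas wm)
    have "AE z in M. \<forall>i\<in>UNIV. adjoint_residual S g \<psi> Ud U P i z = 2 * wlap S (cmp U i) z"
      using R by (intro AE_finite_allI) auto
    then show "AE z in M. (\<Sum>i\<in>UNIV. 2 * (wpd S ex (cmp U i) z * wpd S ex (cmp V i) z + wpd S ey (cmp U i) z * wpd S ey (cmp V i) z)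
       + cmp V i z * adjoint_residual S g \<psi> Ud U P i z) = 2 * ?B z"
      by eventually_elim (simp add: sum_distrib_left distrib_left ac_simps)
  qed
  also have "\<dots> = 0"
    using bdry V bounded by (simp add: no_boundary_term_def Let_def)
  finally show "lagrangian_has_dir_deriv \<Omega> T g \<psi> U0 Ud U P V 0"
    using lagrangian_dir_deriv[OF def VH bounded] by simp
qed

end

theorem theorem4p1:
  fixes \<Omega> :: "plane set" and n :: "plane \<Rightarrow> plane" and T g :: real
    and \<psi> :: "plane \<Rightarrow> real" and U0 :: "plane \<Rightarrow> real ^ 3" and Ud U P :: field
  assumes "regular_domain \<Omega> n" and "0 < T" and "0 < g"
    and "\<forall>x. \<psi> differentiable (at x)"
    and "\<forall>i. L2 (cyl \<Omega> T) (cmp Ud i)"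
    and "solves_shallow_water \<Omega> T n g \<psi> U0 U"
    and "\<exists>c>0. AE z in lebesgue_on (cyl \<Omega> T). c \<le> cmp U 1 z"
    and "P \<in> W_space \<Omega> T n g U"
  shows "(adjoint_equation \<Omega> T n g \<psi> U0 Ud U P \<longrightarrow>
            strong_adjoint_system \<Omega> T g \<psi> Ud U P \<and>
            time_value \<Omega> T P T (\<lambda>_. 0) \<and>
            no_normal_flux \<Omega> T n (cmp P 2) (cmp P 3) \<and>
            momentum_flux_condition \<Omega> T n g U P)
       \<and> (lagrangian_defined \<Omega> T \<psi> U0 U P \<and>
            strong_adjoint_system \<Omega> T g \<psi> Ud U P \<and>
            no_boundary_term \<Omega> T n U \<longrightarrow>
            adjoint_equation \<Omega> T n g \<psi> U0 Ud U P)"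
proof -
  obtain k where "0 < k" "AE z in lebesgue_on (cyl \<Omega> T). k \<le> cmp U 1 z"
    using assms(7) by blast
  moreover have "U \<in> V_space \<Omega> T n"
    using assms(6) by (simp add: solves_shallow_water_def Let_def)
  ultimately interpret adjoint_setting \<Omega> T g \<psi> Ud U P k
    using assms by unfold_locales (auto simp: regular_domain_def V_space_def W_space_def)
  \<comment> \<open>The final condition and both boundary conditions are clauses of membership in
    the adjoint space; the differential equations come from the adjoint equation.\<close>
  show ?thesis
    using adjoint_equation_imp_strong strong_imp_adjoint_equation assms(8)
    unfolding W_space_def by blast
qed

end
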